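(* Fix an integer $q\ge 2$. For any $\epsilon, \kappa > 0$, the following holds for all sufficiently large $n$. Let $G$ be an $n$-vertex graph with $m \leq \kappa n^2$ edges which maximizes the number of proper $q$-colorings among $n$-vertex graphs with $m$ edges. Then $G$ is $\epsilon n^2$-close to some graph $G_{\boldsymbol\alpha}(n)$ (Construction 1), for some ${\boldsymbol\alpha}$ which solves $\mathrm{OPT}(\gamma)$ for some $\gamma$ with $|\gamma - m/n^2| \leq \epsilon$ and $\gamma \leq \kappa$.
   Context: Logarithms are natural. Vectors ${\boldsymbol\alpha}$ have real coordinates $\alpha_A$ indexed by the nonempty subsets $A\subseteq[q]$. $\mathrm{OBJ}({\boldsymbol\alpha}) = \sum_A \alpha_A\log|A|$, $\mathrm{V}({\boldsymbol\alpha})=\sum_A\alpha_A$, $\mathrm{E}({\boldsymbol\alpha}) = \sum_{\{A,B\}:A\cap B=\emptyset}\alpha_A\alpha_B$ (unordered pairs of disjoint nonempty sets). $\mathrm{FEAS}(\gamma)=\{{\boldsymbol\alpha}\ge 0: \mathrm{V}({\boldsymbol\alpha})=1,\ \mathrm{E}({\boldsymbol\alpha})\ge\gamma\}$, $\mathrm{OPT}(\gamma)=\max_{\mathrm{FEAS}(\gamma)}\mathrm{OBJ}$, and ${\boldsymbol\alpha}$ solves $\mathrm{OPT}(\gamma)$ if ${\boldsymbol\alpha}\in\mathrm{FEAS}(\gamma)$ and $\mathrm{OBJ}({\boldsymbol\alpha})=\mathrm{OPT}(\gamma)$. Construction 1 ($G_{\boldsymbol\alpha}(n)$): partition $n$ vertices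 into clusters $V_A$ with $|n\alpha_A-|V_A||<1$, and join $V_A$ completely to $V_B$ whenever $A\cap B=\emptyset$; no other edges. Two graphs with the same number of vertices are $d$-close if their edit distance (minimum number of edge additions/deletions to make one isomorphic to the other) is at most $d$.
   Formalization: The formal statement also assumes that G has at least one proper q-coloring; without this the claim fails, e.g. for q=2, κ=1, ε=1/100 and G=K_n, which vacuously maximizes with 0 colorings while FEAS(γ) is empty for every γ near m/n². *)

theory Defs
  imports Complex_Main "HOL-Library.FuncSet" "HOL-Library.Disjoint_Sets"
begin

subsection \<open>Finite simple graphs\<close>

type_synonym 'a graph = "'a set \<times> 'a set set"

abbreviation verts :: "'a graph \<Rightarrow> 'a set" where "verts \<equiv> fst"
abbreviation edges :: "'a graph \<Rightarrow> 'a set set" where "edges \<equiv> snd"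

definition simple_graph :: "'a graph \<Rightarrow> bool" where
  "simple_graph G \<longleftrightarrow> finite (verts G) \<and> edges G \<subseteq> {e. e \<subseteq> verts G \<and> card e = 2}"

definition graph_with :: "nat \<Rightarrow> nat \<Rightarrow> 'a graph \<Rightarrow> bool" where
  "graph_with n m G \<longleftrightarrow> simple_graph G \<and> card (verts G) = n \<and> card (edges G) = m"

definition proper_colorings :: "nat \<Rightarrow> 'a graph \<Rightarrow> ('a \<Rightarrow> nat) set" where
  "proper_colorings q G =
     {c \<in> verts G \<rightarrow>\<^sub>E {1..q}. \<forall>u v. {u, v} \<in> edges G \<longrightarrow> c u \<noteq> c v}"

definition num_colorings :: "nat \<Rightarrow> 'a graph \<Rightarrow> nat" where
  "num_colorings q G = card (proper_colorings q G)"

definition maximizes_colorings :: "nat \<Rightarrow> nat \<Rightarrow> nat \<Rightarrow> 'a graph \<Rightarrow> bool" where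
  "maximizes_colorings q n m G \<longleftrightarrow> graph_with n m G \<and>
     (\<forall>H :: 'a graph. graph_with n m H \<longrightarrow> num_colorings q H \<le> num_colorings q G)"

definition isomorphic :: "'a graph \<Rightarrow> 'b graph \<Rightarrow> bool" where
  "isomorphic G H \<longleftrightarrow>
     (\<exists>f. bij_betw f (verts G) (verts H) \<and> edges H = (\<lambda>e. f ` e) ` edges G)"

text \<open>
  The edges added to and deleted from \<open>G\<close> form the symmetric difference of the old and
  the new edge set. The minimum is over a nonempty set only if the graphs have equally
  many vertices, as \<open>is_close\<close> demands.
\<close>
definition edit_distance :: "'a graph \<Rightarrow> 'b graph \<Rightarrow> nat" where
  "edit_distance G H = (LEAST k. \<exists>E'. simple_graph (verts G, E') \<and>
     card ((E' - edges G) \<union> (edges G - E')) = k \<and> isomorphic (verts G, E') H)"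

definition is_close :: "real \<Rightarrow> 'a graph \<Rightarrow> 'b graph \<Rightarrow> bool" where
  "is_close d G H \<longleftrightarrow> card (verts G) = card (verts H) \<and> real (edit_distance G H) \<le> d"

subsection \<open>The optimization problem\<close>

text \<open>
  Vectors are functions \<open>nat set \<Rightarrow> real\<close>; only their values on \<open>indices q\<close> matter.
\<close>
definition indices :: "nat \<Rightarrow> nat set set" where
  "indices q = {A. A \<subseteq> {1..q} \<and> A \<noteq> {}}"

definition OBJ :: "nat \<Rightarrow> (nat set \<Rightarrow> real) \<Rightarrow> real" where
  "OBJ q \<alpha> = (\<Sum>A\<in>indices q. \<alpha> A * ln (real (card A)))"

definition VV :: "nat \<Rightarrow> (nat set \<Rightarrow> real) \<Rightarrow> real" where
  "VV q \<alpha> = (\<Sum>A\<in>indices q. \<alpha> A)"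

definition disjoint_pairs :: "nat \<Rightarrow> nat set set set" where
  "disjoint_pairs q = {{A, B} | A B. A \<in> indices q \<and> B \<in> indices q \<and> A \<inter> B = {}}"

text \<open>
  Disjoint nonempty sets are distinct, so every \<open>P = {A, B}\<close> below has exactly two
  elements and the inner product is \<open>\<alpha> A * \<alpha> B\<close>.
\<close>
definition EE :: "nat \<Rightarrow> (nat set \<Rightarrow> real) \<Rightarrow> real" where
  "EE q \<alpha> = (\<Sum>P\<in>disjoint_pairs q. \<Prod>A\<in>P. \<alpha> A)"

definition FEAS :: "nat \<Rightarrow> real \<Rightarrow> (nat set \<Rightarrow> real) set" where
  "FEAS q \<gamma> = {\<alpha>. (\<forall>A\<in>indices q. \<alpha> A \<ge> 0) \<and> VV q \<alpha> = 1 \<and> EE q \<alpha> \<ge> \<gamma>}"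

definition OPT :: "nat \<Rightarrow> real \<Rightarrow> real" where
  "OPT q \<gamma> = (GREATEST v. v \<in> OBJ q ` FEAS q \<gamma>)"

definition solves_OPT :: "nat \<Rightarrow> real \<Rightarrow> (nat set \<Rightarrow> real) \<Rightarrow> bool" where
  "solves_OPT q \<gamma> \<alpha> \<longleftrightarrow> \<alpha> \<in> FEAS q \<gamma> \<and> OBJ q \<alpha> = OPT q \<gamma>"

subsection \<open>The graphs built from a vector\<close>

text \<open>
  The cluster sizes are not determined by \<open>\<alpha>\<close> and \<open>n\<close>, so the construction is a
  predicate on graphs. Clusters may be empty.
\<close>
definition is_G_alpha :: "nat \<Rightarrow> (nat set \<Rightarrow> real) \<Rightarrow> nat \<Rightarrow> 'a graph \<Rightarrow> bool" where
  "is_G_alpha q \<alpha> n H \<longleftrightarrow> finite (verts H) \<and> card (verts H) = n \<and>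
     (\<exists>C :: nat set \<Rightarrow> 'a set.
        disjoint_family_on C (indices q) \<and> (\<Union>A\<in>indices q. C A) = verts H \<and>
        (\<forall>A\<in>indices q. \<bar>real n * \<alpha> A - real (card (C A))\<bar> < 1) \<and>
        edges H = {{u, v} | u v A B. A \<in> indices q \<and> B \<in> indices q \<and> A \<inter> B = {} \<and>
                                     u \<in> C A \<and> v \<in> C B})"

end

theory Submission
  imports Defs "HOL-Analysis.Analysis"
begin

text \<open>
  Every colour class is an independent set, hence lies in a container: the set of vertices outside
  the neighbourhood of a bounded-size fingerprint that have few neighbours outside it. There are
  only polynomially many \<open>q\<close>-tuples of fingerprints, so one of them accounts for almost all
  colourings on the exponential scale. Labelling each vertex by the set of colours whose container
  it belongs to gives a vector \<open>\<alpha>\<close> with \<open>OBJ\<close> at least about \<open>ln (num_colorings q G) / n\<close>, and all but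
  \<open>o(n\<^sup>2)\<close> edges of \<open>G\<close> join disjoint labels, so that \<open>EE\<close> is at least about \<open>m / n\<^sup>2\<close>. For a
  sequence of counterexamples pass to a limit \<open>(\<alpha>, \<gamma>)\<close>. A feasible vector with larger
  objective could be perturbed to have \<open>EE > \<gamma>\<close>, and the graphs built from it would beat the
  maximizers; so \<open>\<alpha>\<close> solves \<open>OPT(\<gamma>)\<close>. Optimality forces \<open>EE \<alpha> = \<gamma>\<close>, because otherwise mass could
  be moved to the full colour set; hence \<open>G\<close> has almost all edges between disjoint labels and is
  close to the graph built from \<open>\<alpha>\<close>.
\<close>

section \<open>Unordered pairs and the edge functional\<close>

text \<open>Double counting: each unordered pair comes from exactly two ordered ones, distinct
  because \<open>P\<close> is irreflexive on \<open>I\<close>. It serves both for \<open>EE\<close>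
  and for counting \<open>label_edges\<close>.\<close>

lemma sum_unordered_pairs:
  fixes f :: "'a set \<Rightarrow> real"
  assumes "finite I" and sym: "\<And>a b. P a b \<Longrightarrow> P b a" and irr: "\<And>a. a \<in> I \<Longrightarrow> \<not> P a a"
  shows "2 * (\<Sum>e\<in>{{a, b} | a b. a \<in> I \<and> b \<in> I \<and> P a b}. f e)
    = (\<Sum>a\<in>I. \<Sum>b\<in>I. if P a b then f {a, b} else 0)"
proof -
  define T where "T = {(a, b). a \<in> I \<and> b \<in> I \<and> P a b}"
  have TS: "T \<subseteq> I \<times> I" by (auto simp: T_def)
  then have fT: "finite T" using \<open>finite I\<close> finite_subset by blast
  have im: "(\<lambda>(a, b). {a, b}) ` T = {{a, b} | a b. a \<in> I \<and> b \<in> I \<and> P a b}"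
    by (auto simp: T_def image_def)
  have fib: "(\<Sum>p\<in>{p \<in> T. (\<lambda>(a, b). {a, b}) p = e}. (\<lambda>(a, b). f {a, b}) p) = 2 * f e"
    if e: "e \<in> (\<lambda>(a, b). {a, b}) ` T" for e
  proof -
    obtain a b where ab: "(a, b) \<in> T" "e = {a, b}" using e by auto
    have ne: "a \<noteq> b" using ab irr by (auto simp: T_def)
    have "{p \<in> T. (\<lambda>(a, b). {a, b}) p = e} = {(a, b), (b, a)}"
      using ab sym by (auto simp: T_def doubleton_eq_iff)
    then show ?thesis using ne ab by (simp add: insert_commute)
  qed
  have "(\<Sum>a\<in>I. \<Sum>b\<in>I. if P a b then f {a, b} else 0)
      = (\<Sum>p\<in>I \<times> I. if p \<in> T then (\<lambda>(a, b). f {a, b}) p else 0)"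
    unfolding sum.cartesian_product by (rule sum.cong) (auto simp: T_def split: if_splits)
  also have "\<dots> = (\<Sum>p\<in>T. (\<lambda>(a, b). f {a, b}) p)"
    using TS \<open>finite I\<close> by (simp add: sum.inter_restrict[symmetric] Int_absorb1)
  also have "\<dots> = (\<Sum>e\<in>(\<lambda>(a, b). {a, b}) ` T. \<Sum>p\<in>{p \<in> T. (\<lambda>(a, b). {a, b}) p = e}. (\<lambda>(a, b). f {a, b}) p)"
    by (rule sum.image_gen[OF fT])
  also have "\<dots> = (\<Sum>e\<in>(\<lambda>(a, b). {a, b}) ` T. 2 * f e)"
    by (rule sum.cong[OF refl fib])
  finally show ?thesis by (simp add: im sum_distrib_left)
qed

lemma finite_indices [simp, intro]: "finite (indices q)"
  unfolding indices_def by (rule finite_subset[of _ "Pow {1..q}"]) auto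

lemma card_indices_pos: "A \<in> indices q \<Longrightarrow> card A > 0"
  unfolding indices_def by (auto simp: card_gt_0_iff intro: finite_subset)

text \<open>Turns \<open>EE\<close> into a quadratic form over ordered pairs, on which limits,
  transfers of mass and edge counts can be computed directly.\<close>

lemma EE_eq:
  "EE q \<alpha> = (\<Sum>A\<in>indices q. \<Sum>B\<in>indices q. if A \<inter> B = {} then \<alpha> A * \<alpha> B else 0) / 2"
proof -
  have "2 * EE q \<alpha> = (\<Sum>A\<in>indices q. \<Sum>B\<in>indices q. if A \<inter> B = {} then (\<Prod>C\<in>{A, B}. \<alpha> C) else 0)"
    unfolding EE_def disjoint_pairs_def
    by (rule sum_unordered_pairs) (auto simp: indices_def)
  also have "\<dots> = (\<Sum>A\<in>indices q. \<Sum>B\<in>indices q. if A \<inter> B = {} then \<alpha> A * \<alpha> B else 0)"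
  proof (intro sum.cong refl)
    fix A B assume "A \<in> indices q" "B \<in> indices q"
    then have "A \<inter> B = {} \<Longrightarrow> A \<noteq> B" by (auto simp: indices_def)
    then show "(if A \<inter> B = {} then (\<Prod>C\<in>{A, B}. \<alpha> C) else 0) = (if A \<inter> B = {} then \<alpha> A * \<alpha> B else 0)"
      by auto
  qed
  finally show ?thesis by simp
qed

subsection \<open>Labelled vertex sets\<close>

text \<open>A labelling stands for the family of clusters \<open>{v \<in> V. L v = A}\<close>, and
  this is the edge set of the construction with these clusters. Nonempty labels exclude
  loops.\<close>

definition label_edges :: "'a set \<Rightarrow> ('a \<Rightarrow> nat set) \<Rightarrow> 'a set set" where
  "label_edges V L = {{u, v} | u v. u \<in> V \<and> v \<in> V \<and> L u \<inter> L v = {}}"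

definition profile :: "'a set \<Rightarrow> ('a \<Rightarrow> nat set) \<Rightarrow> nat set \<Rightarrow> real" where
  "profile V L A = real (card {v \<in> V. L v = A}) / real (card V)"

lemma sum_profile:
  assumes "finite V" "V \<noteq> {}" "L \<in> V \<rightarrow> indices q"
  shows "(\<Sum>A\<in>indices q. profile V L A * f A) = (\<Sum>v\<in>V. f (L v)) / real (card V)"
proof -
  have "(\<Sum>v\<in>V. f (L v)) = (\<Sum>A\<in>indices q. \<Sum>v\<in>{v \<in> V. L v = A}. f (L v))"
    by (rule sum.group[symmetric]) (use assms in auto)
  also have "\<dots> = (\<Sum>A\<in>indices q. real (card {v \<in> V. L v = A}) * f A)"
    by (intro sum.cong refl) simp
  finally show ?thesis by (simp add: profile_def sum_divide_distrib)
qed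

text \<open>For the normalised label counts there is no rounding error: \<open>OBJ\<close> is
  exactly the mean of the logarithms of the label sizes, and \<open>EE\<close> is exactly the edge
  density of \<open>label_edges\<close>. Both follow by grouping vertices by label.\<close>

lemma
  assumes "finite V" "V \<noteq> {}" "L \<in> V \<rightarrow> indices q"
  shows VV_profile: "VV q (profile V L) = 1"
    and OBJ_profile: "real (card V) * OBJ q (profile V L) = (\<Sum>v\<in>V. ln (real (card (L v))))"
    and EE_profile: "real (card (label_edges V L)) = EE q (profile V L) * real (card V) ^ 2"
proof -
  have n: "real (card V) > 0" using assms by (simp add: card_gt_0_iff)
  show "VV q (profile V L) = 1"
    using sum_profile[OF assms, of "\<lambda>_. 1"] n by (simp add: VV_def)
  show "real (card V) * OBJ q (profile V L) = (\<Sum>v\<in>V. ln (real (card (L v))))"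
    using sum_profile[OF assms, of "\<lambda>A. ln (real (card A))"] n by (simp add: OBJ_def)
  have "2 * real (card (label_edges V L)) = (\<Sum>u\<in>V. \<Sum>v\<in>V. if L u \<inter> L v = {} then 1 else 0)"
  proof -
    have "2 * (\<Sum>e\<in>{{u, v} | u v. u \<in> V \<and> v \<in> V \<and> L u \<inter> L v = {}}. 1::real)
      = (\<Sum>u\<in>V. \<Sum>v\<in>V. if L u \<inter> L v = {} then 1 else 0)"
      by (rule sum_unordered_pairs) (use assms in \<open>auto simp: indices_def Pi_def\<close>)
    then show ?thesis by (simp add: label_edges_def)
  qed
  also have "\<dots> = (\<Sum>u\<in>V. real (card V) * (\<Sum>B\<in>indices q. profile V L B * (if L u \<inter> B = {} then 1 else 0)))"
    using n by (simp add: sum_profile[OF assms])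
  also have "\<dots> = real (card V) * (\<Sum>u\<in>V. \<Sum>B\<in>indices q. profile V L B * (if L u \<inter> B = {} then 1 else 0))"
    by (simp add: sum_distrib_left)
  also have "(\<Sum>u\<in>V. \<Sum>B\<in>indices q. profile V L B * (if L u \<inter> B = {} then 1 else 0))
    = real (card V) * (\<Sum>A\<in>indices q. profile V L A * (\<Sum>B\<in>indices q. profile V L B * (if A \<inter> B = {} then 1 else 0)))"
    using n sum_profile[OF assms, of "\<lambda>A. \<Sum>B\<in>indices q. profile V L B * (if A \<inter> B = {} then 1 else 0)"]
    by simp
  also have "(\<Sum>A\<in>indices q. profile V L A * (\<Sum>B\<in>indices q. profile V L B * (if A \<inter> B = {} then 1 else 0)))
    = (\<Sum>A\<in>indices q. \<Sum>B\<in>indices q. if A \<inter> B = {} then profile V L A * profile V L B else 0)"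
    unfolding sum_distrib_left by (intro sum.cong refl) auto
  also have "\<dots> = 2 * EE q (profile V L)"
    by (simp add: EE_eq)
  finally show "real (card (label_edges V L)) = EE q (profile V L) * real (card V) ^ 2"
    by (simp add: power2_eq_square)
qed

lemma finite_label_edges: "finite V \<Longrightarrow> finite (label_edges V L)"
  by (rule finite_subset[of _ "Pow V"]) (auto simp: label_edges_def)

lemma label_edges_card_2:
  assumes "L \<in> V \<rightarrow> indices q"
  shows "label_edges V L \<subseteq> {e. e \<subseteq> V \<and> card e = 2}"
proof
  fix e assume "e \<in> label_edges V L"
  then obtain u v where e: "e = {u, v}" "u \<in> V" "v \<in> V" "L u \<inter> L v = {}"
    by (auto simp: label_edges_def)
  then have "u \<noteq> v" using assms by (auto simp: indices_def)
  then show "e \<in> {e. e \<subseteq> V \<and> card e = 2}" using e by auto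
qed

text \<open>Choosing for each vertex any colour of its label gives a proper colouring, as the ends
  of every edge have disjoint labels. \<open>E\<close> may be a proper subset of
  \<open>label_edges\<close>, so that edges can be discarded to reach a prescribed number.\<close>

lemma prod_card_le_num_colorings:
  assumes "finite V" "E \<subseteq> label_edges V L" "L \<in> V \<rightarrow> indices q"
  shows "(\<Prod>v\<in>V. card (L v)) \<le> num_colorings q (V, E)"
proof -
  have sub: "PiE V L \<subseteq> proper_colorings q (V, E)"
  proof
    fix c assume c: "c \<in> PiE V L"
    have "c \<in> V \<rightarrow>\<^sub>E {1..q}"
    proof (rule PiE_I)
      fix v assume v: "v \<in> V"
      have "L v \<in> indices q" using assms(3) v by (rule funcset_mem)
      then have "L v \<subseteq> {1..q}" by (simp add: indices_def)
      moreover have "c v \<in> L v" using c v by (rule PiE_mem)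
      ultimately show "c v \<in> {1..q}" by blast
    next
      fix v assume "v \<notin> V"
      then show "c v = undefined" by (rule PiE_arb[OF c])
    qed
    moreover have "c u \<noteq> c v" if uv: "{u, v} \<in> E" for u v
    proof -
      have "{u, v} \<in> label_edges V L" by (rule subsetD[OF assms(2) uv])
      then have "\<exists>x y. {u, v} = {x, y} \<and> x \<in> V \<and> y \<in> V \<and> L x \<inter> L y = {}"
        by (simp only: label_edges_def mem_Collect_eq)
      then obtain x y where xy: "{u, v} = {x, y}" "x \<in> V" "y \<in> V" "L x \<inter> L y = {}"
        by (elim exE conjE)
      have "c x \<in> L x" "c y \<in> L y" using PiE_mem[OF c] xy(2,3) by blast+
      with xy(4) have "c x \<noteq> c y" by (metis disjoint_iff)
      then show ?thesis using xy(1) by (auto simp: doubleton_eq_iff)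
    qed
    ultimately show "c \<in> proper_colorings q (V, E)" by (simp add: proper_colorings_def)
  qed
  have "finite (proper_colorings q (V, E))"
    by (rule finite_subset[of _ "V \<rightarrow>\<^sub>E {1..q}"]) (auto simp: proper_colorings_def assms finite_PiE)
  from card_mono[OF this sub] show ?thesis
    by (simp add: num_colorings_def card_PiE assms)
qed

lemma is_G_alpha_label_edges:
  assumes "finite V" "card V = n" "L \<in> V \<rightarrow> indices q"
    and "\<And>A. A \<in> indices q \<Longrightarrow> \<bar>real n * \<alpha> A - real (card {v \<in> V. L v = A})\<bar> < 1"
  shows "is_G_alpha q \<alpha> n (V, label_edges V L)"
  unfolding is_G_alpha_def
proof (intro conjI exI[of _ "\<lambda>A. {v \<in> V. L v = A}"])
  show "edges (V, label_edges V L) = {{u, v} | u v A B. A \<in> indices q \<and> B \<in> indices q \<and> A \<inter> B = {} \<and>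
      u \<in> {v \<in> V. L v = A} \<and> v \<in> {v \<in> V. L v = B}}"
    using funcset_mem[OF assms(3)] unfolding label_edges_def snd_conv by blast
  show "(\<Union>A\<in>indices q. {v \<in> V. L v = A}) = verts (V, label_edges V L)"
    using assms(3) by auto
qed (use assms in \<open>auto simp: disjoint_family_on_def label_edges_def\<close>)

subsection \<open>Containers\<close>

definition nbrs :: "'a graph \<Rightarrow> 'a \<Rightarrow> 'a set" where
  "nbrs G v = {u \<in> verts G. {u, v} \<in> edges G}"

text \<open>The container depends on the fingerprint \<open>S\<close> alone and not on the
  independent set that \<open>S\<close> was chosen from, so counting fingerprints counts
  containers.\<close>

definition container :: "'a graph \<Rightarrow> real \<Rightarrow> 'a set \<Rightarrow> 'a set" where
  "container G d S = {v \<in> verts G. v \<notin> (\<Union>s\<in>S. nbrs G s) \<and> real (card (nbrs G v - (\<Union>s\<in>S. nbrs G s))) < d}"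

lemma nbrs_subset: "nbrs G v \<subseteq> verts G"
  by (auto simp: nbrs_def)

text \<open>
  Take a largest \<open>S \<subseteq> I\<close> with \<open>\<bar>N(S)\<bar> \<ge> d \<bar>S\<bar>\<close>: a vertex of \<open>I\<close> with \<open>d\<close> neighbours outside \<open>N(S)\<close>
  could be added to it.
\<close>
lemma container_exists:
  assumes G: "simple_graph G" and I: "I \<subseteq> verts G" and d: "d > 0"
    and ind: "\<And>u v. u \<in> I \<Longrightarrow> v \<in> I \<Longrightarrow> {u, v} \<notin> edges G"
  obtains S where "S \<subseteq> I" "d * real (card S) \<le> real (card (verts G))" "I \<subseteq> container G d S"
proof -
  have fV: "finite (verts G)" using G by (simp add: simple_graph_def)
  have fI: "finite I" using I fV by (rule finite_subset)
  define N where "N S = (\<Union>s\<in>S. nbrs G s)" for S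
  have NV: "N S \<subseteq> verts G" for S unfolding N_def by (intro UN_least nbrs_subset)
  have fN: "finite (N S)" for S using NV fV by (rule finite_subset)
  define F where "F = {S. S \<subseteq> I \<and> d * real (card S) \<le> real (card (N S))}"
  have fF: "finite F" by (rule finite_subset[of _ "Pow I"]) (auto simp: F_def fI)
  have "{} \<in> F" by (simp add: F_def)
  then have "Max (card ` F) \<in> card ` F" using fF by (intro Max_in) auto
  then obtain S where S: "S \<in> F" "Max (card ` F) = card S" by (rule imageE)
  have Smax: "card T \<le> card S" if "T \<in> F" for T
    using that fF by (simp flip: S(2))
  have SI: "S \<subseteq> I" and SN: "d * real (card S) \<le> real (card (N S))" using S(1) by (auto simp: F_def)
  have fS: "finite S" using SI fI by (rule finite_subset)
  have "I \<subseteq> container G d S"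
  proof
    fix v assume v: "v \<in> I"
    have "v \<notin> N S" using ind[OF v] SI by (auto simp: N_def nbrs_def)
    moreover have "real (card (nbrs G v - N S)) < d"
    proof (rule ccontr)
      assume c: "\<not> real (card (nbrs G v - N S)) < d"
      have "v \<notin> S"
      proof
        assume "v \<in> S"
        then have "nbrs G v - N S = {}" by (auto simp: N_def)
        then have "card (nbrs G v - N S) = 0" by (simp only: card.empty)
        then show False using c d by simp
      qed
      have "N (insert v S) = (nbrs G v - N S) \<union> N S" by (auto simp: N_def)
      moreover have "finite (nbrs G v - N S)" using nbrs_subset fV by (meson finite_Diff finite_subset)
      ultimately have "card (N (insert v S)) = card (nbrs G v - N S) + card (N S)"
        using card_Un_disjoint[of "nbrs G v - N S" "N S"] fN[of S] by (simp only:) blast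
      then have "insert v S \<in> F"
        using v SI SN c fS \<open>v \<notin> S\<close> by (simp add: F_def algebra_simps)
      then have "card (insert v S) \<le> card S" by (rule Smax)
      then show False using fS \<open>v \<notin> S\<close> by simp
    qed
    ultimately show "v \<in> container G d S" using v I by (auto simp: container_def N_def)
  qed
  \<comment> \<open>\<open>N S\<close> has at most \<open>card (verts G)\<close> elements, so the
    fingerprint size is bounded by a constant once \<open>d\<close> is linear in the number of
    vertices.\<close>
  moreover have "d * real (card S) \<le> real (card (verts G))"
    using SN card_mono[OF fV NV[of S]] by linarith
  ultimately show ?thesis using SI that by blast
qed

text \<open>Container vertices avoid N(S), so the neighbours of \<open>v\<close> inside the
  container are among its fewer than \<open>d\<close> neighbours outside N(S). Summing these degrees
  counts every inner edge at least once.\<close>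

lemma card_edges_container:
  assumes G: "simple_graph G" and d: "d \<ge> 0"
  shows "real (card {e \<in> edges G. e \<subseteq> container G d S}) \<le> real (card (verts G)) * d"
proof -
  define C where "C = container G d S"
  have fV: "finite (verts G)" using G by (simp add: simple_graph_def)
  have CV: "C \<subseteq> verts G" by (auto simp: C_def container_def)
  have fC: "finite C" using CV fV by (rule finite_subset)
  have deg: "real (card (nbrs G v \<inter> C)) \<le> d" if "v \<in> C" for v
  proof -
    have "nbrs G v \<inter> C \<subseteq> nbrs G v - (\<Union>s\<in>S. nbrs G s)" by (auto simp: C_def container_def)
    moreover have "finite (nbrs G v - (\<Union>s\<in>S. nbrs G s))"
      using nbrs_subset fV by (meson finite_Diff finite_subset)
    ultimately have "card (nbrs G v \<inter> C) \<le> card (nbrs G v - (\<Union>s\<in>S. nbrs G s))" by (rule card_mono[rotated])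
    then show ?thesis using that by (auto simp: C_def container_def)
  qed
  have "{e \<in> edges G. e \<subseteq> C} \<subseteq> (\<lambda>(v, u). {u, v}) ` (SIGMA v:C. nbrs G v \<inter> C)"
  proof
    fix e assume e: "e \<in> {e \<in> edges G. e \<subseteq> C}"
    then have "card e = 2" using G by (auto simp: simple_graph_def)
    then obtain u v where "e = {u, v}" by (auto simp: card_2_iff)
    with e CV show "e \<in> (\<lambda>(v, u). {u, v}) ` (SIGMA v:C. nbrs G v \<inter> C)"
      by (intro image_eqI[of _ _ "(v, u)"]) (auto simp: nbrs_def)
  qed
  then have "card {e \<in> edges G. e \<subseteq> C} \<le> card (SIGMA v:C. nbrs G v \<inter> C)"
    by (rule surj_card_le[rotated]) (use fC in auto)
  also have "\<dots> = (\<Sum>v\<in>C. card (nbrs G v \<inter> C))" using fC by simp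
  finally have "real (card {e \<in> edges G. e \<subseteq> C}) \<le> (\<Sum>v\<in>C. real (card (nbrs G v \<inter> C)))"
    by (simp flip: of_nat_sum)
  also have "\<dots> \<le> (\<Sum>v\<in>C. d)" by (rule sum_mono) (rule deg)
  also have "\<dots> \<le> real (card (verts G)) * d"
    using d card_mono[OF fV CV] by (simp add: mult_right_mono)
  finally show ?thesis by (simp add: C_def)
qed

section \<open>Counting fingerprints and bounding the number of colourings\<close>

lemma sum_power_le: "(\<Sum>i\<le>k. n ^ i) \<le> Suc n ^ k"
proof (induction k)
  case (Suc k)
  have "n * n ^ k \<le> n * Suc n ^ k" by (intro mult_left_mono power_mono) auto
  from add_mono[OF Suc this] show ?case by simp
qed simp

text \<open>A set of size at most \<open>k\<close> is the set of entries of a list of length at most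
  \<open>k\<close>, and such lists are counted by a geometric sum. For fixed \<open>k\<close> the
  bound is polynomial.\<close>

lemma card_small_subsets:
  assumes "finite V"
  shows "card {S. S \<subseteq> V \<and> card S \<le> k} \<le> Suc (card V) ^ k"
proof -
  have "{S. S \<subseteq> V \<and> card S \<le> k} \<subseteq> set ` {xs. set xs \<subseteq> V \<and> length xs \<le> k}"
  proof
    fix S assume S: "S \<in> {S. S \<subseteq> V \<and> card S \<le> k}"
    then have "finite S" using assms finite_subset by blast
    then obtain xs where "set xs = S" "distinct xs" using finite_distinct_list by blast
    with S show "S \<in> set ` {xs. set xs \<subseteq> V \<and> length xs \<le> k}"
      by (intro image_eqI[of _ _ xs]) (auto simp: distinct_card)
  qed
  then have "card {S. S \<subseteq> V \<and> card S \<le> k} \<le> card {xs. set xs \<subseteq> V \<and> length xs \<le> k}"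
    by (rule surj_card_le[rotated]) (rule finite_lists_length_le[OF assms])
  then show ?thesis using sum_power_le[of "card V" k] by (simp add: card_lists_length_le[OF assms])
qed

text \<open>Pigeonhole: the largest fibre is at least as large as the average one. Having
  \<open>y\<close> in the image makes the fibre nonempty.\<close>

lemma fibre_large:
  assumes "finite X" "finite Y" "f ` X \<subseteq> Y" "X \<noteq> {}"
  obtains y where "y \<in> f ` X" "card X \<le> card Y * card {x \<in> X. f x = y}"
proof -
  define M where "M = Max ((\<lambda>y. card {x \<in> X. f x = y}) ` f ` X)"
  have "M \<in> (\<lambda>y. card {x \<in> X. f x = y}) ` f ` X"
    unfolding M_def by (rule Max_in) (use assms in auto)
  then obtain y where y: "y \<in> f ` X" "M = card {x \<in> X. f x = y}" by auto
  have "card X = (\<Sum>y\<in>f ` X. card {x \<in> X. f x = y})"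
    using sum.image_gen[OF assms(1), of "\<lambda>_. 1::nat" f] by simp
  also have "\<dots> \<le> (\<Sum>y\<in>f ` X. M)"
    by (rule sum_mono) (use assms in \<open>auto simp: M_def intro!: Max_ge\<close>)
  also have "\<dots> \<le> card Y * M" using card_mono[OF assms(2,3)] by simp
  finally show ?thesis using y that by simp
qed

text \<open>Fix the most frequent tuple \<open>T\<close> of fingerprints of colour classes and label
  each vertex with the colours whose container holds it. Colourings with tuple \<open>T\<close> take
  their values in the labels, which gives the upper bound; edges between intersecting labels lie
  inside one of \<open>q\<close> containers, which are sparse.\<close>

lemma container_labelling:
  assumes G: "simple_graph G" and pos: "num_colorings q G > 0" and d: "d > 0"
    and k: "real (card (verts G)) \<le> d * real k"
  obtains L where "L \<in> verts G \<rightarrow> indices q"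
    "num_colorings q G \<le> (Suc (card (verts G)) ^ k) ^ q * (\<Prod>v\<in>verts G. card (L v))"
    "real (card (edges G - label_edges (verts G) L)) \<le> real q * (real (card (verts G)) * d)"
proof -
  let ?V = "verts G" and ?X = "proper_colorings q G"
  define Y where "Y = {1..q} \<rightarrow>\<^sub>E {S. S \<subseteq> ?V \<and> card S \<le> k}"
  have fV: "finite ?V" using G by (simp add: simple_graph_def)
  have XP: "?X \<subseteq> ?V \<rightarrow>\<^sub>E {1..q}" by (auto simp: proper_colorings_def)
  have fX: "finite ?X" by (rule finite_subset[OF XP]) (simp add: finite_PiE fV)
  have fY: "finite Y" unfolding Y_def using fV by (intro finite_PiE) auto
  have "\<exists>S. S \<subseteq> ?V \<and> card S \<le> k \<and> {v \<in> ?V. c v = i} \<subseteq> container G d S" if c: "c \<in> ?X" for c i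
  proof -
    have "{u, v} \<notin> edges G" if "u \<in> {v \<in> ?V. c v = i}" "v \<in> {v \<in> ?V. c v = i}" for u v
    proof
      assume "{u, v} \<in> edges G"
      then have "c u \<noteq> c v" using c unfolding proper_colorings_def by blast
      then show False using that by simp
    qed
    then obtain S where S: "S \<subseteq> {v \<in> ?V. c v = i}" "d * real (card S) \<le> real (card ?V)"
      "{v \<in> ?V. c v = i} \<subseteq> container G d S"
      using container_exists[OF G _ d, of "{v \<in> ?V. c v = i}"] by blast
    have "d * real (card S) \<le> d * real k" using S(2) k by linarith
    then have "card S \<le> k" using d by simp
    then show ?thesis using S by blast
  qed
  then obtain s where s: "\<And>c i. c \<in> ?X \<Longrightarrow>
      s c i \<subseteq> ?V \<and> card (s c i) \<le> k \<and> {v \<in> ?V. c v = i} \<subseteq> container G d (s c i)"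
    by metis
  define f where "f c = restrict (s c) {1..q}" for c
  have fXY: "f ` ?X \<subseteq> Y"
  proof
    fix y assume "y \<in> f ` ?X"
    then obtain c where c: "c \<in> ?X" "y = f c" by blast
    show "y \<in> Y" unfolding c(2) f_def Y_def restrict_PiE_iff using s[OF c(1)] by simp
  qed
  have "?X \<noteq> {}" using pos by (auto simp: num_colorings_def)
  then obtain T where T: "T \<in> f ` ?X" "card ?X \<le> card Y * card {c \<in> ?X. f c = T}"
    using fibre_large[OF fX fY fXY] by blast
  define L where "L v = {i \<in> {1..q}. v \<in> container G d (T i)}" for v
  have cL: "c v \<in> L v" if "c \<in> ?X" "f c = T" "v \<in> ?V" for c v
  proof -
    have cq: "c v \<in> {1..q}" using XP that by (meson PiE_mem subsetD)
    have "v \<in> container G d (s c (c v))" using s[OF that(1), of "c v"] that(3) by auto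
    moreover have "T (c v) = s c (c v)" using that(2) cq by (auto simp: f_def)
    ultimately show ?thesis using cq by (simp add: L_def)
  qed
  \<comment> \<open>One colouring in the fibre suffices to make all labels nonempty: each label
    contains the colour that \<open>c0\<close> gives to the vertex.\<close>
  obtain c0 where c0: "c0 \<in> ?X" "f c0 = T" using T(1) by blast
  have LV: "L \<in> ?V \<rightarrow> indices q"
  proof
    fix v assume "v \<in> ?V"
    then have "L v \<noteq> {}" using cL[OF c0] by blast
    then show "L v \<in> indices q" by (auto simp: indices_def L_def)
  qed
  have fL: "finite (L v)" for v by (simp add: L_def)
  have "{c \<in> ?X. f c = T} \<subseteq> PiE ?V L"
  proof
    fix c assume "c \<in> {c \<in> ?X. f c = T}"
    then have c: "c \<in> ?X" "f c = T" by auto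
    have "c \<in> ?V \<rightarrow>\<^sub>E {1..q}" using XP c(1) by blast
    then show "c \<in> PiE ?V L" by (intro PiE_I cL[OF c]) (auto intro: PiE_arb)
  qed
  then have "card {c \<in> ?X. f c = T} \<le> card (PiE ?V L)"
    by (rule card_mono[rotated]) (intro finite_PiE fV fL)
  then have 1: "card {c \<in> ?X. f c = T} \<le> (\<Prod>v\<in>?V. card (L v))" by (simp add: card_PiE fV)
  have "card Y = card {S. S \<subseteq> ?V \<and> card S \<le> k} ^ q" by (simp add: Y_def card_PiE)
  then have 2: "card Y \<le> (Suc (card ?V) ^ k) ^ q"
    using card_small_subsets[OF fV] by (simp add: power_mono)
  have A: "num_colorings q G \<le> (Suc (card ?V) ^ k) ^ q * (\<Prod>v\<in>?V. card (L v))"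
    using T(2) mult_le_mono[OF 2 1] by (simp add: num_colorings_def)
  have "edges G - label_edges ?V L \<subseteq> (\<Union>i\<in>{1..q}. {e \<in> edges G. e \<subseteq> container G d (T i)})"
  proof
    fix e assume e: "e \<in> edges G - label_edges ?V L"
    then have "card e = 2" "e \<subseteq> ?V" using G by (auto simp: simple_graph_def)
    then obtain u v where uv: "e = {u, v}" "u \<in> ?V" "v \<in> ?V" by (auto simp: card_2_iff)
    \<comment> \<open>A common colour of the two labels puts both ends of the edge into the
      container of that colour.\<close>
    then have "L u \<inter> L v \<noteq> {}" using e by (auto simp: label_edges_def)
    then show "e \<in> (\<Union>i\<in>{1..q}. {e \<in> edges G. e \<subseteq> container G d (T i)})"
      using uv(1) e by (auto simp: L_def)
  qed
  moreover have "finite (edges G)"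
    using G fV by (auto simp: simple_graph_def intro: finite_subset[of _ "Pow ?V"])
  ultimately have "card (edges G - label_edges ?V L) \<le> card (\<Union>i\<in>{1..q}. {e \<in> edges G. e \<subseteq> container G d (T i)})"
    by (intro card_mono) auto
  also have "\<dots> \<le> (\<Sum>i\<in>{1..q}. card {e \<in> edges G. e \<subseteq> container G d (T i)})"
    by (rule card_UN_le) simp
  finally have "real (card (edges G - label_edges ?V L)) \<le> (\<Sum>i\<in>{1..q}. real (card {e \<in> edges G. e \<subseteq> container G d (T i)}))"
    by (simp flip: of_nat_sum)
  also have "\<dots> \<le> (\<Sum>i\<in>{1..q}. real (card ?V) * d)"
    using d by (intro sum_mono card_edges_container G) simp
  finally show ?thesis using that[OF LV A] by simp
qed

text \<open>With \<open>d\<close> proportional to \<open>n\<close> the fingerprint size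
  \<open>k\<close> does not depend on \<open>n\<close>, so the logarithm of the number of
  fingerprint tuples is of order ln n, far below \<delta> n.\<close>

lemma eventually_container_labelling:
  assumes q: "q > 0" and \<delta>: "\<delta> > 0"
  shows "\<forall>\<^sub>F n in sequentially. \<forall>G :: 'a graph. simple_graph G \<longrightarrow> card (verts G) = n \<longrightarrow> num_colorings q G > 0 \<longrightarrow>
    (\<exists>L. L \<in> verts G \<rightarrow> indices q \<and>
      ln (real (num_colorings q G)) \<le> (\<Sum>v\<in>verts G. ln (real (card (L v)))) + \<delta> * real n \<and>
      real (card (edges G - label_edges (verts G) L)) \<le> \<delta> * real n ^ 2)"
proof -
  define k where "k = nat \<lceil>real q / \<delta>\<rceil>"
  have k: "real q / \<delta> \<le> real k" unfolding k_def by linarith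
  have "(\<lambda>n. ln (real (Suc n)) / real (Suc n)) \<longlonglongrightarrow> 0"
    using lim_ln_over_n LIMSEQ_Suc by blast
  \<comment> \<open>This factor turns the denominator n + 1 of the shifted limit back into
    n.\<close>
  moreover have "(\<lambda>n. 1 + inverse (real n)) \<longlonglongrightarrow> 1 + 0"
    by (intro tendsto_intros lim_inverse_n)
  ultimately have "(\<lambda>n. real k * real q * (ln (real (Suc n)) / real (Suc n) * (1 + inverse (real n))))
      \<longlonglongrightarrow> real k * real q * (0 * (1 + 0))"
    by (rule tendsto_mult[OF tendsto_const tendsto_mult])
  then have "\<forall>\<^sub>F n in sequentially. real k * real q * (ln (real (Suc n)) / real (Suc n) * (1 + inverse (real n))) < \<delta>"
    using \<delta> by (intro order_tendstoD(2)) auto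
  then show ?thesis
    using eventually_gt_at_top[of 0]
  proof eventually_elim
    case (elim n)
    have "ln (real (Suc n)) / real (Suc n) * (1 + inverse (real n)) = ln (real (Suc n)) / real n"
      using elim(2) by (simp add: divide_simps)
    with elim(1) have "real k * real q * (ln (real (Suc n)) / real n) < \<delta>"
      by (simp only:)
    then have small: "real k * real q * ln (real (Suc n)) < \<delta> * real n"
      using elim(2) by (simp add: pos_divide_less_eq)
    show ?case
    proof (intro allI impI)
      fix G :: "'a graph"
      assume G: "simple_graph G" "card (verts G) = n" "num_colorings q G > 0"
      \<comment> \<open>With this choice the \<open>q\<close> containers, each with at most n d
        inner edges, cost \<delta> n^2 in total, and fingerprints have size at most q /
        \<delta>.\<close>
      define d where "d = \<delta> * real n / real q"
      have d: "d > 0" using \<delta> elim q by (simp add: d_def)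
      have "real n = d * (real q / \<delta>)" using \<delta> q by (simp add: d_def)
      also have "\<dots> \<le> d * real k" using k d by (intro mult_left_mono) auto
      finally have nk: "real (card (verts G)) \<le> d * real k" using G by simp
      obtain L where L: "L \<in> verts G \<rightarrow> indices q"
        "num_colorings q G \<le> (Suc n ^ k) ^ q * (\<Prod>v\<in>verts G. card (L v))"
        "real (card (edges G - label_edges (verts G) L)) \<le> real q * (real n * d)"
        using container_labelling[OF G(1,3) d nk] unfolding G(2) by blast
      have Lp: "real (card (L v)) > 0" if "v \<in> verts G" for v
        using card_indices_pos[OF funcset_mem[OF L(1) that]] by simp
      have P: "real (\<Prod>v\<in>verts G. card (L v)) > 0" using Lp by (simp add: prod_pos)
      have "real (num_colorings q G) \<le> real ((Suc n ^ k) ^ q * (\<Prod>v\<in>verts G. card (L v)))"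
        using L(2) by (simp only: of_nat_le_iff)
      then have "ln (real (num_colorings q G)) \<le> ln (real ((Suc n ^ k) ^ q * (\<Prod>v\<in>verts G. card (L v))))"
        using G(3) P by (subst ln_le_cancel_iff) (auto intro!: mult_pos_pos)
      also have "\<dots> = ln ((real (Suc n) ^ k) ^ q) + ln (real (\<Prod>v\<in>verts G. card (L v)))"
        unfolding of_nat_mult of_nat_power using P by (intro ln_mult_pos) auto
      also have "ln (real (\<Prod>v\<in>verts G. card (L v))) = (\<Sum>v\<in>verts G. ln (real (card (L v))))"
        unfolding of_nat_prod by (rule ln_prod) (use G Lp in \<open>auto simp: simple_graph_def\<close>)
      also have "ln ((real (Suc n) ^ k) ^ q) = real k * real q * ln (real (Suc n))"
        by (simp add: ln_realpow flip: power_mult)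
      finally have "ln (real (num_colorings q G)) \<le> (\<Sum>v\<in>verts G. ln (real (card (L v)))) + \<delta> * real n"
        using small by linarith
      moreover have "real q * (real n * d) = \<delta> * real n ^ 2"
        using q by (simp add: d_def power2_eq_square)
      ultimately show "\<exists>L. L \<in> verts G \<rightarrow> indices q \<and>
          ln (real (num_colorings q G)) \<le> (\<Sum>v\<in>verts G. ln (real (card (L v)))) + \<delta> * real n \<and>
          real (card (edges G - label_edges (verts G) L)) \<le> \<delta> * real n ^ 2"
        using L(1,3) by (intro exI[of _ L]) simp
    qed
  qed
qed

subsection \<open>Perturbing a weight vector\<close>

lemma EE_tendsto:
  assumes "\<And>A. A \<in> indices q \<Longrightarrow> (\<lambda>n. a n A) \<longlonglongrightarrow> \<alpha> A"
  shows "(\<lambda>n. EE q (a n)) \<longlonglongrightarrow> EE q \<alpha>"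
  unfolding EE_eq
proof (intro tendsto_divide tendsto_sum tendsto_const)
  fix A B assume "A \<in> indices q" "B \<in> indices q"
  then show "(\<lambda>n. if A \<inter> B = {} then a n A * a n B else 0) \<longlonglongrightarrow> (if A \<inter> B = {} then \<alpha> A * \<alpha> B else 0)"
    using assms by (auto intro!: tendsto_mult)
qed simp

lemma OBJ_tendsto:
  assumes "\<And>A. A \<in> indices q \<Longrightarrow> (\<lambda>n. a n A) \<longlonglongrightarrow> \<alpha> A"
  shows "(\<lambda>n. OBJ q (a n)) \<longlonglongrightarrow> OBJ q \<alpha>"
  unfolding OBJ_def by (intro tendsto_sum tendsto_mult_right assms)

text \<open>The mass \<open>t\<close> goes from \<open>A\<close> to \<open>B\<close>. Writing the
  change as a difference of indicators lets the quadratic form be expanded.\<close>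

definition move :: "real \<Rightarrow> nat set \<Rightarrow> nat set \<Rightarrow> (nat set \<Rightarrow> real) \<Rightarrow> nat set \<Rightarrow> real" where
  "move t A B \<alpha> = (\<lambda>C. \<alpha> C + (if C = B then t else 0) - (if C = A then t else 0))"

lemma VV_move:
  assumes "A \<in> indices q" "B \<in> indices q"
  shows "VV q (move t A B \<alpha>) = VV q \<alpha>"
  using assms by (simp add: VV_def move_def sum.distrib sum_subtractf)

text \<open>The change is exactly linear in \<open>t\<close>: the quadratic term involves only the
  pairs formed from \<open>A\<close> and \<open>B\<close>, and none of these is disjoint. The linear
  coefficient compares the weight disjoint from \<open>B\<close> with that disjoint from
  \<open>A\<close>.\<close>

lemma EE_move:
  assumes A: "A \<in> indices q" and B: "B \<in> indices q" and AB: "A \<inter> B \<noteq> {}"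
  shows "EE q (move t A B \<alpha>) = EE q \<alpha> +
    t * ((\<Sum>C\<in>indices q. if B \<inter> C = {} then \<alpha> C else 0) - (\<Sum>C\<in>indices q. if A \<inter> C = {} then \<alpha> C else 0))"
proof -
  define x where "x C = (if C = B then t else 0) - (if C = A then t else 0)" for C
  define d where "d C D = (if C \<inter> D = {} then 1 else (0::real))" for C D :: "nat set"
  have e: "EE q \<beta> = (\<Sum>C\<in>indices q. \<Sum>D\<in>indices q. d C D * \<beta> C * \<beta> D) / 2" for \<beta>
    unfolding EE_eq d_def by (intro arg_cong[where f = "\<lambda>x. x / 2"] sum.cong refl) auto
  have xs: "(\<Sum>C\<in>indices q. x C * f C) = t * (f B - f A)" for f
    using A B by (simp add: x_def left_diff_distrib sum_subtractf if_distrib[of "\<lambda>z. z * _"] right_diff_distrib cong: if_cong)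
  have dA: "d A A = 0" "d B B = 0" "d A B = 0" "d B A = 0"
    using A B AB by (auto simp: d_def indices_def)
  have sym: "d C D = d D C" for C D by (simp add: d_def Int_commute)
  have "move t A B \<alpha> C = \<alpha> C + x C" for C by (simp add: move_def x_def)
  then have "2 * EE q (move t A B \<alpha>) = (\<Sum>C\<in>indices q. \<Sum>D\<in>indices q. d C D * (\<alpha> C + x C) * (\<alpha> D + x D))"
    by (simp add: e)
  also have "\<dots> = (\<Sum>C\<in>indices q. \<Sum>D\<in>indices q. d C D * \<alpha> C * \<alpha> D) + (\<Sum>C\<in>indices q. \<Sum>D\<in>indices q. x D * (d C D * \<alpha> C))
      + (\<Sum>C\<in>indices q. x C * (\<Sum>D\<in>indices q. d C D * \<alpha> D)) + (\<Sum>C\<in>indices q. x C * (\<Sum>D\<in>indices q. x D * d C D))"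
    by (simp add: sum_distrib_left algebra_simps sum.distrib)
  also have "(\<Sum>C\<in>indices q. \<Sum>D\<in>indices q. x D * (d C D * \<alpha> C)) = (\<Sum>C\<in>indices q. x C * (\<Sum>D\<in>indices q. d C D * \<alpha> D))"
    by (subst sum.swap) (simp add: sum_distrib_left sym)
  also have "(\<Sum>C\<in>indices q. x C * (\<Sum>D\<in>indices q. x D * d C D)) = 0"
    by (simp add: xs dA)
  finally have "EE q (move t A B \<alpha>) = EE q \<alpha> + (\<Sum>C\<in>indices q. x C * (\<Sum>D\<in>indices q. d C D * \<alpha> D))"
    by (simp add: e)
  also have "(\<Sum>C\<in>indices q. x C * (\<Sum>D\<in>indices q. d C D * \<alpha> D)) = t * ((\<Sum>D\<in>indices q. d B D * \<alpha> D) - (\<Sum>D\<in>indices q. d A D * \<alpha> D))"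
    by (rule xs)
  finally show ?thesis by (simp add: d_def if_distrib[of "\<lambda>z. z * _"] cong: if_cong)
qed

text \<open>
  Replacing a label by a singleton inside it keeps all its neighbours, and two different
  singletons gain each other as neighbours.
\<close>
lemma EE_increase:
  assumes \<alpha>: "\<And>C. C \<in> indices q \<Longrightarrow> \<alpha> C \<ge> 0" and A: "A \<in> indices q" "i \<in> A" "j \<in> A" "i \<noteq> j"
    and t: "0 < t" "2 * t \<le> \<alpha> A"
  defines "\<beta> \<equiv> move t A {j} (move t A {i} \<alpha>)"
  shows "VV q \<beta> = VV q \<alpha>" "EE q \<beta> > EE q \<alpha>" "\<And>C. C \<in> indices q \<Longrightarrow> \<beta> C \<ge> 0"
proof -
  let ?s = "\<lambda>\<alpha> B. \<Sum>C\<in>indices q. if B \<inter> C = {} then \<alpha> C else 0"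
  have ij: "{i} \<in> indices q" "{j} \<in> indices q" and ne: "A \<noteq> {i}" "A \<noteq> {j}"
    using A by (auto simp: indices_def)
  show "VV q \<beta> = VV q \<alpha>" unfolding \<beta>_def using A ij by (simp add: VV_move)
  show \<beta>0: "\<beta> C \<ge> 0" if "C \<in> indices q" for C
    using \<alpha>[OF that] t ne by (auto simp: \<beta>_def move_def)
  have \<gamma>0: "move t A {i} \<alpha> C \<ge> 0" if "C \<in> indices q" for C
    using \<alpha>[OF that] t ne by (auto simp: move_def)
  \<comment> \<open>A label disjoint from \<open>A\<close> is disjoint from \<open>{i}\<close>, so
    the first move cannot lower \<open>EE\<close>.\<close>
  have "?s \<alpha> A \<le> ?s \<alpha> {i}"
    using \<alpha> A by (intro sum_mono) auto
  then have "EE q \<alpha> \<le> EE q (move t A {i} \<alpha>)"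
    using A ij t by (subst EE_move) (auto intro!: mult_nonneg_nonneg)
  \<comment> \<open>The second move gains strictly: \<open>{i}\<close> now has weight at least
    \<open>t\<close>, is disjoint from \<open>{j}\<close>, but meets \<open>A\<close>.\<close>
  also have "?s (move t A {i} \<alpha>) A < ?s (move t A {i} \<alpha>) {j}"
  proof (rule sum_strict_mono_ex1)
    show "\<forall>C\<in>indices q. (if A \<inter> C = {} then move t A {i} \<alpha> C else 0) \<le> (if {j} \<inter> C = {} then move t A {i} \<alpha> C else 0)"
      using \<gamma>0 A by auto
    show "\<exists>C\<in>indices q. (if A \<inter> C = {} then move t A {i} \<alpha> C else 0) < (if {j} \<inter> C = {} then move t A {i} \<alpha> C else 0)"
      using A ij t \<alpha>[OF ij(1)] ne by (intro bexI[of _ "{i}"]) (auto simp: move_def)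
  qed simp
  then have "EE q (move t A {i} \<alpha>) < EE q \<beta>"
    unfolding \<beta>_def using A ij t by (subst (2) EE_move) auto
  finally show "EE q \<beta> > EE q \<alpha>" .
qed

text \<open>Buys strict slack in the edge constraint at an arbitrarily small loss of objective: a
  vanishing part of the weight of a label with two colours is moved to two singletons, and
  \<open>OBJ\<close> is continuous.\<close>

lemma FEAS_improve_EE:
  assumes \<alpha>: "\<alpha> \<in> FEAS q \<gamma>" and obj: "OBJ q \<alpha> > c" and c: "c \<ge> 0"
  obtains \<beta> where "\<beta> \<in> FEAS q \<gamma>" "EE q \<beta> > \<gamma>" "OBJ q \<beta> > c"
proof -
  have \<alpha>0: "\<alpha> C \<ge> 0" if "C \<in> indices q" for C using \<alpha> that by (simp add: FEAS_def)
  \<comment> \<open>If only singletons carried weight, the objective would be 0 because ln 1 = 0,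
    against \<open>OBJ q \<alpha> > c\<close> and \<open>c \<ge> 0\<close>.\<close>
  have "\<exists>A\<in>indices q. \<alpha> A > 0 \<and> card A \<ge> 2"
  proof (rule ccontr)
    assume no: "\<not> (\<exists>A\<in>indices q. \<alpha> A > 0 \<and> card A \<ge> 2)"
    have "\<alpha> A * ln (real (card A)) = 0" if A: "A \<in> indices q" for A
    proof (cases "\<alpha> A = 0")
      case False
      then have "\<alpha> A > 0" using \<alpha>0[OF A] by simp
      with no A have "card A < 2" by force
      then have "card A = 1" using card_indices_pos[OF A] by simp
      then show ?thesis by simp
    qed simp
    then have "OBJ q \<alpha> = 0" unfolding OBJ_def by (intro sum.neutral) auto
    with obj c show False by simp
  qed
  then obtain A where A: "A \<in> indices q" "\<alpha> A > 0" "card A \<ge> 2" by blast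
  then obtain i j where ij: "i \<in> A" "j \<in> A" "i \<noteq> j"
    using card_2_iff' by (metis card_le_Suc0_iff_eq card_gt_0_iff card_indices_pos not_less_eq_eq numeral_2_eq_2)
  \<comment> \<open>The moved amounts tend to 0 and never exceed half of \<open>\<alpha> A\<close>,
    so two moves leave the weight of \<open>A\<close> nonnegative.\<close>
  define b where "b n = move (\<alpha> A / 2 * inverse (real (Suc n))) A {j} (move (\<alpha> A / 2 * inverse (real (Suc n))) A {i} \<alpha>)" for n
  have "(\<lambda>n. b n C) \<longlonglongrightarrow> \<alpha> C" for C
  proof -
    have "(\<lambda>n. \<alpha> A / 2 * inverse (real (Suc n))) \<longlonglongrightarrow> \<alpha> A / 2 * 0"
      by (intro tendsto_intros LIMSEQ_inverse_real_of_nat)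
    then have "(\<lambda>n. b n C) \<longlonglongrightarrow> \<alpha> C + (if C = {i} then \<alpha> A / 2 * 0 else 0) - (if C = A then \<alpha> A / 2 * 0 else 0)
       + (if C = {j} then \<alpha> A / 2 * 0 else 0) - (if C = A then \<alpha> A / 2 * 0 else 0)"
      unfolding b_def move_def by (intro tendsto_add tendsto_diff tendsto_const) (auto intro: tendsto_const)
    then show ?thesis by simp
  qed
  then have "(\<lambda>n. OBJ q (b n)) \<longlonglongrightarrow> OBJ q \<alpha>" by (intro OBJ_tendsto)
  then have "\<forall>\<^sub>F n in sequentially. OBJ q (b n) > c" using obj by (rule order_tendstoD)
  then obtain n where n: "OBJ q (b n) > c" using eventually_happens by force
  have t: "0 < \<alpha> A / 2 * inverse (real (Suc n))" using A by simp
  have "inverse (real (Suc n)) \<le> 1" by (rule inverse_le_1_iff[THEN iffD2]) simp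
  then have "\<alpha> A * inverse (real (Suc n)) \<le> \<alpha> A" using A(2) by (intro mult_left_le) auto
  then have t2: "2 * (\<alpha> A / 2 * inverse (real (Suc n))) \<le> \<alpha> A" by linarith
  have *: "VV q (b n) = VV q \<alpha>" "EE q (b n) > EE q \<alpha>" "\<And>C. C \<in> indices q \<Longrightarrow> b n C \<ge> 0"
    using EE_increase[of q \<alpha> A i j, OF _ A(1) ij t t2] \<alpha>0 unfolding b_def by blast+
  have "EE q (b n) > \<gamma>" using *(2) \<alpha> by (simp add: FEAS_def)
  moreover have "b n \<in> FEAS q \<gamma>" using * \<alpha> by (simp add: FEAS_def)
  ultimately show ?thesis using n that by blast
qed

section \<open>Consequences of optimality\<close>

text \<open>Positive \<open>EE\<close> requires two disjoint labels of positive weight, and these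
  are proper subsets of the colour set. \<open>OBJ\<close> is a weighted mean of ln |A|, so it stays
  strictly below the maximum.\<close>

lemma OBJ_less_ln:
  assumes \<alpha>: "\<And>C. C \<in> indices q \<Longrightarrow> \<alpha> C \<ge> 0" and V: "VV q \<alpha> = 1" and E: "EE q \<alpha> > 0"
  shows "OBJ q \<alpha> < ln (real q)"
proof -
  have "\<exists>A\<in>indices q. \<exists>B\<in>indices q. A \<inter> B = {} \<and> \<alpha> A * \<alpha> B \<noteq> 0"
  proof (rule ccontr)
    assume "\<not> ?thesis"
    then have "EE q \<alpha> = 0" unfolding EE_eq by (auto intro!: sum.neutral)
    with E show False by simp
  qed
  then obtain A B where AB: "A \<in> indices q" "B \<in> indices q" "A \<inter> B = {}" "\<alpha> A * \<alpha> B \<noteq> 0" by blast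
  then have A: "\<alpha> A > 0" using \<alpha>[of A] by auto
  have le: "ln (real (card C)) \<le> ln (real q)" if "C \<in> indices q" for C
  proof -
    have "card C \<le> q" using that card_mono[of "{1..q}" C] by (simp add: indices_def)
    then show ?thesis using card_indices_pos[OF that] by simp
  qed
  have "A \<subset> {1..q}" using AB by (auto simp: indices_def)
  then have "card A < q" using psubset_card_mono[of "{1..q}" A] by simp
  then have lt: "ln (real (card A)) < ln (real q)" using card_indices_pos[OF AB(1)] by simp
  have "OBJ q \<alpha> < (\<Sum>C\<in>indices q. \<alpha> C * ln (real q))"
    unfolding OBJ_def
  proof (rule sum_strict_mono_ex1)
    show "\<forall>C\<in>indices q. \<alpha> C * ln (real (card C)) \<le> \<alpha> C * ln (real q)"
      using le \<alpha> by (auto intro: mult_left_mono)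
    show "\<exists>C\<in>indices q. \<alpha> C * ln (real (card C)) < \<alpha> C * ln (real q)"
      using A lt AB(1) by (intro bexI[of _ A]) auto
  qed simp
  also have "\<dots> = ln (real q)" using V by (simp add: VV_def flip: sum_distrib_right)
  finally show ?thesis .
qed

text \<open>Given slack, mix in a small share of the point mass at \<open>{1..q}\<close>.
  Feasibility survives by continuity, while the linear \<open>OBJ\<close> rises, as the point mass
  has value ln q. Slack over \<open>\<gamma> \<ge> 0\<close> makes \<open>EE\<close> positive, hence
  \<open>OBJ q \<alpha>\<close> smaller than ln q.\<close>

lemma EE_eq_of_maximal:
  assumes q: "q > 0" and \<gamma>: "\<gamma> \<ge> 0" and \<alpha>: "\<alpha> \<in> FEAS q \<gamma>"
    and max: "\<And>\<beta>. \<beta> \<in> FEAS q \<gamma> \<Longrightarrow> OBJ q \<beta> \<le> OBJ q \<alpha>"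
  shows "EE q \<alpha> = \<gamma>"
proof (rule ccontr)
  assume "EE q \<alpha> \<noteq> \<gamma>"
  with \<alpha> have E: "EE q \<alpha> > \<gamma>" by (simp add: FEAS_def)
  have \<alpha>0: "\<alpha> C \<ge> 0" if "C \<in> indices q" for C using \<alpha> that by (simp add: FEAS_def)
  have V: "VV q \<alpha> = 1" using \<alpha> by (simp add: FEAS_def)
  have Q: "{1..q} \<in> indices q" using q by (simp add: indices_def)
  define b where "b n C = (1 - inverse (real (Suc n))) * \<alpha> C + (if C = {1..q} then inverse (real (Suc n)) else 0)" for n C
  have inv: "0 \<le> inverse (real (Suc n))" "inverse (real (Suc n)) \<le> 1" for n by (auto simp: divide_simps)
  have "(\<lambda>n. b n C) \<longlonglongrightarrow> (1 - 0) * \<alpha> C + (if C = {1..q} then 0 else 0)" for C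
    unfolding b_def
  proof (intro tendsto_add tendsto_mult tendsto_diff tendsto_const LIMSEQ_inverse_real_of_nat)
    show "(\<lambda>n. if C = {1..q} then inverse (real (Suc n)) else 0) \<longlonglongrightarrow> (if C = {1..q} then 0 else 0)"
      using LIMSEQ_inverse_real_of_nat by (cases "C = {1..q}") (simp_all only: simp_thms if_True if_False tendsto_const)
  qed
  then have "(\<lambda>n. EE q (b n)) \<longlonglongrightarrow> EE q \<alpha>" by (intro EE_tendsto) simp
  then have "\<forall>\<^sub>F n in sequentially. EE q (b n) > \<gamma>" using E by (rule order_tendstoD)
  then obtain n where n: "EE q (b n) > \<gamma>" using eventually_happens by force
  have "VV q (b n) = (1 - inverse (real (Suc n))) * VV q \<alpha> + inverse (real (Suc n))"
    using Q by (simp add: VV_def b_def sum.distrib flip: sum_distrib_left)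
  then have "b n \<in> FEAS q \<gamma>" using n V \<alpha>0 inv by (auto simp: FEAS_def b_def)
  then have "OBJ q (b n) \<le> OBJ q \<alpha>" by (rule max)
  moreover have "OBJ q (b n) = (1 - inverse (real (Suc n))) * OBJ q \<alpha> + inverse (real (Suc n)) * ln (real q)"
    using Q by (simp add: OBJ_def b_def sum.distrib distrib_right mult.assoc if_distrib[of "\<lambda>x. x * _"] sum_distrib_left cong: if_cong)
  ultimately have "inverse (real (Suc n)) * (ln (real q) - OBJ q \<alpha>) \<le> 0"
    by (simp add: algebra_simps)
  moreover have "OBJ q \<alpha> < ln (real q)" using OBJ_less_ln[OF \<alpha>0 V] E \<gamma> by simp
  ultimately show False by (simp add: mult_le_0_iff)
qed

lemma OBJ_nonneg:
  assumes "\<And>A. A \<in> indices q \<Longrightarrow> \<alpha> A \<ge> 0"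
  shows "OBJ q \<alpha> \<ge> 0"
  unfolding OBJ_def
proof (intro sum_nonneg mult_nonneg_nonneg assms)
  fix A assume "A \<in> indices q"
  then have "1 \<le> real (card A)" using card_indices_pos by fastforce
  then show "0 \<le> ln (real (card A))" by (rule ln_ge_zero)
qed

text \<open>\<open>GREATEST\<close> has the intended value only when a maximum exists; an explicit
  maximiser provides it.\<close>

lemma maximal_solves_OPT:
  assumes "\<alpha> \<in> FEAS q \<gamma>" "\<And>\<beta>. \<beta> \<in> FEAS q \<gamma> \<Longrightarrow> OBJ q \<beta> \<le> OBJ q \<alpha>"
  shows "solves_OPT q \<gamma> \<alpha>"
  unfolding solves_OPT_def OPT_def
proof
  show "OBJ q \<alpha> = (GREATEST v. v \<in> OBJ q ` FEAS q \<gamma>)"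
  proof (rule Greatest_equality[symmetric])
    show "OBJ q \<alpha> \<in> OBJ q ` FEAS q \<gamma>" using assms(1) by (rule imageI)
    show "v \<le> OBJ q \<alpha>" if "v \<in> OBJ q ` FEAS q \<gamma>" for v
      using that assms(2) by (elim imageE) simp
  qed
qed (rule assms)

subsection \<open>Rounding and relabelling\<close>

text \<open>Round everything down, then raise by 1 as many entries as the total lacks. The shortfall
  is at most the number of non-integral entries.\<close>

lemma exists_rounding:
  fixes x :: "'i \<Rightarrow> real"
  assumes "finite I" and x0: "\<And>i. i \<in> I \<Longrightarrow> 0 \<le> x i" and sum: "(\<Sum>i\<in>I. x i) = real n"
  obtains s :: "'i \<Rightarrow> nat" where "(\<Sum>i\<in>I. s i) = n" "\<And>i. i \<in> I \<Longrightarrow> \<bar>x i - real (s i)\<bar> < 1"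
proof -
  define b where "b i = nat \<lfloor>x i\<rfloor>" for i
  have b: "real (b i) \<le> x i" "x i < real (b i) + 1" if "i \<in> I" for i
    using x0[OF that] by (simp_all add: b_def of_nat_nat)
  \<comment> \<open>Only non-integral entries may be raised: at an integral one the error would be
    exactly 1, but the bound is strict.\<close>
  define F where "F = {i \<in> I. x i \<noteq> real (b i)}"
  have "(\<Sum>i\<in>I. real (b i)) \<le> real n" unfolding sum[symmetric] by (intro sum_mono b)
  then have bn: "(\<Sum>i\<in>I. b i) \<le> n" by (simp flip: of_nat_sum)
  have "real n \<le> (\<Sum>i\<in>I. real (b i) + (if i \<in> F then 1 else 0))"
    unfolding sum[symmetric] by (intro sum_mono) (use b in \<open>auto simp: F_def less_imp_le\<close>)
  also have "\<dots> = real ((\<Sum>i\<in>I. b i) + card F)"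
    using assms(1) by (simp add: sum.distrib F_def flip: sum.inter_filter)
  finally have "n - (\<Sum>i\<in>I. b i) \<le> card F" by (simp only: of_nat_le_iff)
  then obtain R where R: "R \<subseteq> F" "card R = n - (\<Sum>i\<in>I. b i)"
    using obtain_subset_with_card_n by metis
  have RI: "R \<subseteq> I" using R(1) by (auto simp: F_def)
  define s where "s i = b i + (if i \<in> R then 1 else 0)" for i
  have "(\<Sum>i\<in>I. s i) = (\<Sum>i\<in>I. b i) + card R"
    using assms(1) RI by (simp add: s_def sum.distrib Int_absorb1 flip: sum.inter_restrict)
  then have "(\<Sum>i\<in>I. s i) = n" using R(2) bn by simp
  moreover have "\<bar>x i - real (s i)\<bar> < 1" if "i \<in> I" for i
  proof (cases "i \<in> R")
    case True
    then have "x i \<noteq> real (b i)" using R(1) by (auto simp: F_def)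
    then show ?thesis using b[OF that] True by (simp add: s_def)
  next
    case False
    then show ?thesis using b[OF that] by (simp add: s_def)
  qed
  ultimately show ?thesis using that by blast
qed

lemma exists_labelling_with_sizes:
  assumes "finite I" "finite R" "(\<Sum>i\<in>I. t i) = card R"
  shows "\<exists>f. f \<in> R \<rightarrow> I \<and> (\<forall>i\<in>I. card {v \<in> R. f v = i} = t i)"
  using assms
proof (induction I arbitrary: R rule: finite_induct)
  case empty
  then show ?case by simp
next
  case (insert i I)
  then have "t i \<le> card R" by simp
  then obtain T where T: "T \<subseteq> R" "card T = t i" "finite T"
    using obtain_subset_with_card_n by metis
  have "sum t I = card (R - T)"
    using insert T by (simp add: card_Diff_subset)
  then obtain f where f: "f \<in> R - T \<rightarrow> I" "\<And>j. j \<in> I \<Longrightarrow> card {v \<in> R - T. f v = j} = t j"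
    using insert.IH[of "R - T"] insert.prems by auto
  define g where "g v = (if v \<in> T then i else f v)" for v
  have "{v \<in> R. g v = i} = T"
    using T(1) f(1) insert.hyps(2) by (auto simp: g_def)
  moreover have "{v \<in> R. g v = j} = {v \<in> R - T. f v = j}" if "j \<in> I" for j
    using that insert.hyps(2) by (auto simp: g_def)
  moreover have "g \<in> R \<rightarrow> insert i I" using f(1) by (auto simp: g_def Pi_iff)
  ultimately show ?case using f(2) T(2) by (intro exI[of _ g]) auto
qed

text \<open>Each class keeps as many of its vertices as its target size allows, and the leftover
  vertices fill the classes that are too small. Only leftovers can change label, and their number is
  the total deficit.\<close>

lemma exists_relabelling:
  assumes I: "finite I" and V: "finite V" and L: "L \<in> V \<rightarrow> I" and s: "(\<Sum>i\<in>I. s i) = card V"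
  obtains L' where "L' \<in> V \<rightarrow> I" "\<forall>i\<in>I. card {v \<in> V. L' v = i} = s i"
    "real (card {v \<in> V. L v \<noteq> L' v}) \<le> (\<Sum>i\<in>I. \<bar>real (card {v \<in> V. L v = i}) - real (s i)\<bar>)"
proof -
  have "\<exists>D. D \<subseteq> {v \<in> V. L v = i} \<and> card D = min (s i) (card {v \<in> V. L v = i})" for i
    using obtain_subset_with_card_n[of "min (s i) (card {v \<in> V. L v = i})" "{v \<in> V. L v = i}"] by auto
  then obtain D where D: "\<And>i. D i \<subseteq> {v \<in> V. L v = i}" "\<And>i. card (D i) = min (s i) (card {v \<in> V. L v = i})"
    by metis
  have fD: "finite (D i)" for i by (rule finite_subset[OF D(1)]) (simp add: V)
  have DL: "x \<in> V" "L x = j" if "x \<in> D j" for x j using D(1)[of j] that by auto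
  define R where "R = V - (\<Union>i\<in>I. D i)"
  have fR: "finite R" using V by (simp add: R_def)
  have DV: "(\<Union>i\<in>I. D i) \<subseteq> V" using D(1) by blast
  have "card (\<Union>i\<in>I. D i) = (\<Sum>i\<in>I. card (D i))"
    by (rule card_UN_disjoint) (use I fD D(1) in blast)+
  then have "card R = (\<Sum>i\<in>I. s i) - (\<Sum>i\<in>I. card (D i))"
    using DV V finite_subset[OF DV V] by (simp add: R_def card_Diff_subset s)
  also have "\<dots> = (\<Sum>i\<in>I. s i - card (D i))"
    by (rule sum_subtractf_nat[symmetric]) (simp add: D(2))
  finally have cR: "card R = (\<Sum>i\<in>I. s i - card (D i))" .
  obtain f where f: "f \<in> R \<rightarrow> I" "\<And>i. i \<in> I \<Longrightarrow> card {v \<in> R. f v = i} = s i - card (D i)"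
    using exists_labelling_with_sizes[OF I fR cR[symmetric]] by blast
  define L' where "L' v = (if v \<in> R then f v else L v)" for v
  have "L' \<in> V \<rightarrow> I" using f(1) L by (auto simp: L'_def)
  moreover have "card {v \<in> V. L' v = i} = s i" if i: "i \<in> I" for i
  proof -
    have "{v \<in> V. L' v = i} = {v \<in> R. f v = i} \<union> D i"
      using DL i by (auto simp: L'_def R_def)
    moreover have "{v \<in> R. f v = i} \<inter> D i = {}" using i by (auto simp: R_def)
    ultimately have "card {v \<in> V. L' v = i} = s i - card (D i) + card (D i)"
      using fR fD f(2)[OF i] by (simp add: card_Un_disjoint)
    then show ?thesis by (simp add: D(2))
  qed
  moreover have "real (card {v \<in> V. L v \<noteq> L' v}) \<le> (\<Sum>i\<in>I. \<bar>real (card {v \<in> V. L v = i}) - real (s i)\<bar>)"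
  proof -
    have "card {v \<in> V. L v \<noteq> L' v} \<le> card R"
      using fR by (intro card_mono) (auto simp: L'_def)
    then have "real (card {v \<in> V. L v \<noteq> L' v}) \<le> (\<Sum>i\<in>I. real (s i - card (D i)))"
      by (simp add: cR flip: of_nat_sum)
    also have "\<dots> \<le> (\<Sum>i\<in>I. \<bar>real (card {v \<in> V. L v = i}) - real (s i)\<bar>)"
      by (intro sum_mono) (simp add: D(2) min_def of_nat_diff)
    finally show ?thesis .
  qed
  ultimately show ?thesis using that by blast
qed

text \<open>Supplies the competitors: a weight vector is realised on a given vertex set.\<close>

lemma exists_proportional_labelling:
  fixes \<alpha> :: "nat set \<Rightarrow> real"
  assumes V: "finite V" and \<alpha>: "\<And>A. A \<in> indices q \<Longrightarrow> 0 \<le> \<alpha> A" and "VV q \<alpha> = 1"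
  shows "\<exists>L. L \<in> V \<rightarrow> indices q \<and>
    (\<forall>A\<in>indices q. \<bar>real (card V) * \<alpha> A - real (card {v \<in> V. L v = A})\<bar> < 1)"
proof -
  have "(\<Sum>A\<in>indices q. real (card V) * \<alpha> A) = real (card V)"
    using assms(3) by (simp add: VV_def flip: sum_distrib_left)
  then obtain s where s: "(\<Sum>A\<in>indices q. s A) = card V"
    "\<And>A. A \<in> indices q \<Longrightarrow> \<bar>real (card V) * \<alpha> A - real (s A)\<bar> < 1"
    using exists_rounding[of "indices q" "\<lambda>A. real (card V) * \<alpha> A"] \<alpha> by auto
  then obtain L where "L \<in> V \<rightarrow> indices q" "\<And>A. A \<in> indices q \<Longrightarrow> card {v \<in> V. L v = A} = s A"
    using exists_labelling_with_sizes[OF finite_indices V s(1)] by blast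
  then show ?thesis using s(2) by auto
qed

section \<open>Edit distance and comparison with a maximizer\<close>

text \<open>A pair whose two ends keep their labels lies in both edge sets or in neither, so each
  differing edge has a relabelled end.\<close>

lemma card_label_edges_diff:
  assumes V: "finite V"
  shows "card ((label_edges V L - label_edges V L') \<union> (label_edges V L' - label_edges V L))
    \<le> card {v \<in> V. L v \<noteq> L' v} * card V"
proof -
  let ?W = "{v \<in> V. L v \<noteq> L' v}"
  have "(label_edges V L - label_edges V L') \<union> (label_edges V L' - label_edges V L)
      \<subseteq> (\<lambda>(u, v). {u, v}) ` (?W \<times> V)"
  proof
    fix e assume e: "e \<in> (label_edges V L - label_edges V L') \<union> (label_edges V L' - label_edges V L)"
    then obtain u v where uv: "e = {u, v}" "u \<in> V" "v \<in> V" by (auto simp: label_edges_def)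
    have "u \<in> ?W \<or> v \<in> ?W"
    proof (rule ccontr)
      assume "\<not> ?thesis"
      then have eq: "L u = L' u" "L v = L' v" using uv by auto
      \<comment> \<open>Stated for arbitrary \<open>M\<close> and \<open>M'\<close> to cover both
        directions of the symmetric difference.\<close>
      have "e \<in> label_edges V M" if "e \<in> label_edges V M'" "M u = M' u" "M v = M' v" for M M' :: "'a \<Rightarrow> nat set"
      proof -
        have "M u \<inter> M v = {}" using that uv(1) by (auto simp: label_edges_def doubleton_eq_iff)
        then show ?thesis using uv unfolding label_edges_def by blast
      qed
      with e eq show False by (metis Diff_iff Un_iff)
    qed
    then show "e \<in> (\<lambda>(u, v). {u, v}) ` (?W \<times> V)"
    proof
      assume "u \<in> ?W"
      then show ?thesis using uv by (intro image_eqI[of _ _ "(u, v)"]) auto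
    next
      assume "v \<in> ?W"
      then show ?thesis using uv by (intro image_eqI[of _ _ "(v, u)"]) auto
    qed
  qed
  then have "card ((label_edges V L - label_edges V L') \<union> (label_edges V L' - label_edges V L)) \<le> card (?W \<times> V)"
    by (rule surj_card_le[rotated]) (use V in auto)
  then show ?thesis by (simp add: card_cartesian_product)
qed

lemma is_close_same_vertices:
  assumes "simple_graph (verts G, E)" "real (card ((E - edges G) \<union> (edges G - E))) \<le> d"
  shows "is_close d G (verts G, E)"
proof -
  have "isomorphic (verts G, E) (verts G, E)"
    unfolding isomorphic_def by (intro exI[of _ id]) auto
  then have "edit_distance G (verts G, E) \<le> card ((E - edges G) \<union> (edges G - E))"
    unfolding edit_distance_def using assms(1) by (intro Least_le exI[of _ E] conjI refl)
  then show ?thesis using assms(2) by (simp add: is_close_def)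
qed

text \<open>The triangle inequality through \<open>label_edges (verts G) L\<close>: it is close to
  \<open>edges G\<close> because few edges of \<open>G\<close> lie outside it and it has hardly more
  than \<open>m\<close> edges, and rounding its classes to sizes prescribed by \<alpha> relabels few
  vertices. The summand \<open>1 / real n\<close> pays for rounding.\<close>

lemma exists_close_G_alpha:
  fixes G :: "'a graph"
  assumes G: "graph_with n m G" and n: "n > 0" and L: "L \<in> verts G \<rightarrow> indices q"
    and \<alpha>: "\<And>A. A \<in> indices q \<Longrightarrow> 0 \<le> \<alpha> A" "VV q \<alpha> = 1"
    and few: "real (card (edges G - label_edges (verts G) L)) \<le> \<delta> * real n ^ 2"
    and le: "2 * \<delta> + (EE q (profile (verts G) L) - real m / real n ^ 2)
      + (\<Sum>A\<in>indices q. \<bar>profile (verts G) L A - \<alpha> A\<bar> + 1 / real n) \<le> \<epsilon>"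
  obtains H :: "'a graph" where "is_G_alpha q \<alpha> n H" "is_close (\<epsilon> * real n ^ 2) G H"
proof -
  let ?V = "verts G" and ?E = "edges G" and ?F = "label_edges (verts G) L"
  have fV: "finite ?V" and cV: "card ?V = n" and EV: "?E \<subseteq> {e. e \<subseteq> ?V \<and> card e = 2}" and cE: "card ?E = m"
    using G by (auto simp: graph_with_def simple_graph_def)
  have V: "?V \<noteq> {}" using cV n by auto
  have fE: "finite ?E" using EV fV by (auto intro: finite_subset[of _ "Pow ?V"])
  have fF: "finite ?F" using fV by (rule finite_label_edges)
  have "(\<Sum>A\<in>indices q. real n * \<alpha> A) = real n"
    using \<alpha>(2) by (simp add: VV_def flip: sum_distrib_left)
  then obtain s where s: "(\<Sum>A\<in>indices q. s A) = n"
    "\<And>A. A \<in> indices q \<Longrightarrow> \<bar>real n * \<alpha> A - real (s A)\<bar> < 1"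
    using exists_rounding[of "indices q" "\<lambda>A. real n * \<alpha> A"] \<alpha>(1) by auto
  obtain L' where L': "L' \<in> ?V \<rightarrow> indices q" "\<forall>A\<in>indices q. card {v \<in> ?V. L' v = A} = s A"
    "real (card {v \<in> ?V. L v \<noteq> L' v}) \<le> (\<Sum>A\<in>indices q. \<bar>real (card {v \<in> ?V. L v = A}) - real (s A)\<bar>)"
    by (rule exists_relabelling[OF finite_indices fV L s(1)[folded cV]])
  let ?F' = "label_edges ?V L'"
  define S where "S = (\<Sum>A\<in>indices q. \<bar>profile ?V L A - \<alpha> A\<bar> + 1 / real n)"
  have "(\<Sum>A\<in>indices q. \<bar>real (card {v \<in> ?V. L v = A}) - real (s A)\<bar>) \<le> (\<Sum>A\<in>indices q. real n * (\<bar>profile ?V L A - \<alpha> A\<bar> + 1 / real n))"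
  proof (rule sum_mono)
    fix A assume A: "A \<in> indices q"
    have "real (card {v \<in> ?V. L v = A}) = real n * profile ?V L A"
      using n by (simp add: profile_def cV)
    then have "\<bar>real (card {v \<in> ?V. L v = A}) - real (s A)\<bar>
        \<le> \<bar>real n * (profile ?V L A - \<alpha> A)\<bar> + \<bar>real n * \<alpha> A - real (s A)\<bar>"
      by (simp add: algebra_simps)
    also have "\<dots> \<le> real n * \<bar>profile ?V L A - \<alpha> A\<bar> + 1"
      using s(2)[OF A] by (simp add: abs_mult)
    finally show "\<bar>real (card {v \<in> ?V. L v = A}) - real (s A)\<bar> \<le> real n * (\<bar>profile ?V L A - \<alpha> A\<bar> + 1 / real n)"
      using n by (simp add: distrib_left)
  qed
  then have W: "real (card {v \<in> ?V. L v \<noteq> L' v}) \<le> real n * S"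
    using L'(3) by (simp add: S_def sum_distrib_left)
  have "real (card ((?F - ?F') \<union> (?F' - ?F))) \<le> real (card {v \<in> ?V. L v \<noteq> L' v} * n)"
    using card_label_edges_diff[OF fV, of L L'] cV by (simp only: of_nat_le_iff)
  also have "\<dots> \<le> real n * S * real n" using W by (simp add: mult_right_mono)
  finally have d1: "real (card ((?F - ?F') \<union> (?F' - ?F))) \<le> S * real n ^ 2"
    by (simp add: power2_eq_square mult_ac)
  \<comment> \<open>Both sides count the union of \<open>?E\<close> and \<open>?F\<close>. As |F -
    E| is computed from |E - F|, the latter enters the distance twice, whence
    \<open>2 * \<delta>\<close>.\<close>
  have "card ?F + card (?E - ?F) = card ?E + card (?F - ?E)"
    using card_Int_Diff[OF fF, of ?E] card_Int_Diff[OF fE, of ?F] by (simp add: Int_commute)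
  then have "real (card (?F - ?E)) = EE q (profile ?V L) * real n ^ 2 + real (card (?E - ?F)) - real m"
    using EE_profile[OF fV V L] cE cV by simp
  also have "real m = real m / real n ^ 2 * real n ^ 2" using n by simp
  finally have d2: "real (card (?F - ?E)) + real (card (?E - ?F))
      \<le> (2 * \<delta> + (EE q (profile ?V L) - real m / real n ^ 2)) * real n ^ 2"
    using few by (simp add: algebra_simps)
  have "card ((?F' - ?E) \<union> (?E - ?F')) \<le> card (((?F - ?F') \<union> (?F' - ?F)) \<union> ((?F - ?E) \<union> (?E - ?F)))"
    using fE fF finite_label_edges[OF fV, of L'] by (intro card_mono) auto
  also have "\<dots> \<le> card ((?F - ?F') \<union> (?F' - ?F)) + (card (?F - ?E) + card (?E - ?F))"
    by (rule order_trans[OF card_Un_le add_left_mono[OF card_Un_le]])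
  finally have "real (card ((?F' - ?E) \<union> (?E - ?F'))) \<le> (2 * \<delta> + (EE q (profile ?V L) - real m / real n ^ 2) + S) * real n ^ 2"
    using d1 d2 by (simp add: distrib_right)
  also have "\<dots> \<le> \<epsilon> * real n ^ 2" using le by (intro mult_right_mono) (auto simp: S_def)
  finally have "is_close (\<epsilon> * real n ^ 2) G (?V, ?F')"
    using fV label_edges_card_2[OF L'(1)] by (intro is_close_same_vertices) (auto simp: simple_graph_def)
  moreover have "is_G_alpha q \<alpha> n (?V, ?F')"
    using fV cV L'(1) by (rule is_G_alpha_label_edges) (use L'(2) s(2) in auto)
  ultimately show ?thesis using that by blast
qed

text \<open>Any \<open>m\<close> of the at least \<open>m\<close> label edges form a competitor to
  \<open>G\<close> on the same vertices, with at least as many colourings as the product of the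
  label sizes.\<close>

lemma maximizer_lower_bound:
  fixes G :: "'a graph"
  assumes G: "maximizes_colorings q n m G" and n: "n > 0"
    and L: "L \<in> verts G \<rightarrow> indices q" and m: "real m \<le> EE q (profile (verts G) L) * real n ^ 2"
  shows "real n * OBJ q (profile (verts G) L) \<le> ln (real (num_colorings q G))"
proof -
  let ?V = "verts G"
  have fV: "finite ?V" and cV: "card ?V = n"
    using G by (auto simp: maximizes_colorings_def graph_with_def simple_graph_def)
  have V: "?V \<noteq> {}" using cV n by auto
  have "m \<le> card (label_edges ?V L)" using m EE_profile[OF fV V L] cV by simp
  then obtain E where E: "E \<subseteq> label_edges ?V L" "card E = m"
    using obtain_subset_with_card_n by metis
  have "graph_with n m (?V, E)"
    using E label_edges_card_2[OF L] fV cV by (auto simp: graph_with_def simple_graph_def)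
  then have "num_colorings q (?V, E) \<le> num_colorings q G"
    using G by (auto simp: maximizes_colorings_def)
  then have le: "(\<Prod>v\<in>?V. card (L v)) \<le> num_colorings q G"
    using prod_card_le_num_colorings[OF fV E(1) L] by linarith
  have pos: "real (card (L v)) > 0" if "v \<in> ?V" for v
    using card_indices_pos[OF funcset_mem[OF L that]] by simp
  have "(\<Sum>v\<in>?V. ln (real (card (L v)))) = ln (\<Prod>v\<in>?V. real (card (L v)))"
    by (rule ln_prod[symmetric]) (use fV pos in auto)
  also have "\<dots> \<le> ln (real (num_colorings q G))"
  proof (rule ln_mono)
    show "0 < (\<Prod>v\<in>?V. real (card (L v)))" using pos by (rule prod_pos)
    show "(\<Prod>v\<in>?V. real (card (L v))) \<le> real (num_colorings q G)"
      using le by (simp flip: of_nat_prod)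
  qed
  finally show ?thesis using OBJ_profile[OF fV V L] cV by simp
qed

subsection \<open>Passing to the limit\<close>

text \<open>Bolzano-Weierstrass, one coordinate at a time; vectors remain plain functions,
  controlled on \<open>I\<close> only.\<close>

lemma convergent_subsequence:
  fixes a :: "nat \<Rightarrow> 'i \<Rightarrow> real"
  assumes "finite I" "\<And>n i. i \<in> I \<Longrightarrow> \<bar>a n i\<bar> \<le> B i"
  shows "\<exists>r l. strict_mono r \<and> (\<forall>i\<in>I. (\<lambda>n. a (r n) i) \<longlonglongrightarrow> l i)"
  using assms
proof (induction I rule: finite_induct)
  case empty
  then show ?case by (intro exI[of _ id]) (simp add: strict_mono_def)
next
  case (insert i I)
  then obtain r l where r: "strict_mono r" "\<And>j. j \<in> I \<Longrightarrow> (\<lambda>n. a (r n) j) \<longlonglongrightarrow> l j"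
    by (metis insertCI)
  have "bounded (range (\<lambda>n. a (r n) i))"
    using insert.prems by (auto simp: bounded_iff)
  then obtain c r' where r': "strict_mono r'" "(\<lambda>n. a (r (r' n)) i) \<longlonglongrightarrow> c"
    using bounded_imp_convergent_subsequence[of "\<lambda>n. a (r n) i"] by (auto simp: o_def)
  have "(\<lambda>n. a ((r \<circ> r') n) j) \<longlonglongrightarrow> (if j = i then c else l j)" if "j \<in> insert i I" for j
  proof (cases "j = i")
    case False
    then have "(\<lambda>n. a (r n) j) \<longlonglongrightarrow> l j" using r(2) that by simp
    from LIMSEQ_subseq_LIMSEQ[OF this r'(1)] show ?thesis using False by (simp add: o_def)
  qed (use r' in simp)
  then show ?case
    using strict_mono_o[OF r(1) r'(1)]
    by (intro exI[of _ "r \<circ> r'"] exI[of _ "\<lambda>j. if j = i then c else l j"]) blast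
qed

text \<open>Positivity of \<open>num_colorings\<close> excludes the degenerate case in which no
  graph with these parameters is q-colourable, so that every one of them is a maximizer.\<close>

theorem theorem3p3:
  fixes q :: nat and \<epsilon> \<kappa> :: real
  assumes "q \<ge> 2" and "\<epsilon> > 0" and "\<kappa> > 0"
  shows "\<exists>N :: nat. \<forall>n \<ge> N. \<forall>(m :: nat) (G :: nat graph).
    real m \<le> \<kappa> * real n ^ 2 \<longrightarrow>
    maximizes_colorings q n m G \<longrightarrow>
    num_colorings q G > 0 \<longrightarrow>
    (\<exists>(\<alpha> :: nat set \<Rightarrow> real) (\<gamma> :: real) (H :: nat graph).
       \<bar>\<gamma> - real m / real n ^ 2\<bar> \<le> \<epsilon> \<and> \<gamma> \<le> \<kappa> \<and>
       solves_OPT q \<gamma> \<alpha> \<and>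
       is_G_alpha q \<alpha> n H \<and>
       is_close (\<epsilon> * real n ^ 2) G H)"
proof (rule ccontr)
  define good where "good n m G \<longleftrightarrow> (\<exists>(\<alpha> :: nat set \<Rightarrow> real) (\<gamma> :: real) (H :: nat graph).
       \<bar>\<gamma> - real m / real n ^ 2\<bar> \<le> \<epsilon> \<and> \<gamma> \<le> \<kappa> \<and> solves_OPT q \<gamma> \<alpha> \<and>
       is_G_alpha q \<alpha> n H \<and> is_close (\<epsilon> * real n ^ 2) G H)" for n m :: nat and G :: "nat graph"
  assume "\<not> ?thesis"
  then have bad: "\<exists>n\<ge>N. \<exists>m (G :: nat graph). real m \<le> \<kappa> * real n ^ 2 \<and> maximizes_colorings q n m G \<and>
      num_colorings q G > 0 \<and> \<not> good n m G" for N
    unfolding good_def by blast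
  define \<delta> where "\<delta> k = inverse (real (Suc k))" for k
  have \<delta>0: "\<delta> \<longlonglongrightarrow> 0" unfolding \<delta>_def by (rule LIMSEQ_inverse_real_of_nat)
  have q0: "q > 0" using assms(1) by simp
  \<comment> \<open>The k-th counterexample has more than \<open>k\<close> vertices and container
    error \<open>\<delta> k\<close>, so all errors vanish along the sequence.\<close>
  have "\<exists>n m (G :: nat graph) L. n > k \<and> real m \<le> \<kappa> * real n ^ 2 \<and> maximizes_colorings q n m G \<and> \<not> good n m G \<and>
      L \<in> verts G \<rightarrow> indices q \<and>
      ln (real (num_colorings q G)) \<le> (\<Sum>v\<in>verts G. ln (real (card (L v)))) + \<delta> k * real n \<and>
      real (card (edges G - label_edges (verts G) L)) \<le> \<delta> k * real n ^ 2" for k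
  proof -
    have "\<delta> k > 0" by (simp add: \<delta>_def)
    from eventually_container_labelling[OF q0 this, where 'a = nat] obtain N where N:
      "\<And>n (G :: nat graph). n \<ge> N \<Longrightarrow> simple_graph G \<Longrightarrow> card (verts G) = n \<Longrightarrow> num_colorings q G > 0 \<Longrightarrow>
        \<exists>L. L \<in> verts G \<rightarrow> indices q \<and>
          ln (real (num_colorings q G)) \<le> (\<Sum>v\<in>verts G. ln (real (card (L v)))) + \<delta> k * real n \<and>
          real (card (edges G - label_edges (verts G) L)) \<le> \<delta> k * real n ^ 2"
      unfolding eventually_sequentially by blast
    obtain n m and G :: "nat graph" where *: "n \<ge> max N (Suc k)" "real m \<le> \<kappa> * real n ^ 2"
      "maximizes_colorings q n m G" "num_colorings q G > 0" "\<not> good n m G"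
      using bad by metis
    have "simple_graph G" "card (verts G) = n" using *(3) by (auto simp: maximizes_colorings_def graph_with_def)
    moreover have "N \<le> n" "k < n" using *(1) by auto
    ultimately show ?thesis using N[of n G] *(2-5) by blast
  qed
  then obtain n m and G :: "nat \<Rightarrow> nat graph" and L where
    n: "\<And>k. n k > k" and m\<kappa>: "\<And>k. real (m k) \<le> \<kappa> * real (n k) ^ 2" and
    mx: "\<And>k. maximizes_colorings q (n k) (m k) (G k)" and ng: "\<And>k. \<not> good (n k) (m k) (G k)" and
    L: "\<And>k. L k \<in> verts (G k) \<rightarrow> indices q" and
    ub: "\<And>k. ln (real (num_colorings q (G k))) \<le> (\<Sum>v\<in>verts (G k). ln (real (card (L k v)))) + \<delta> k * real (n k)" and
    few: "\<And>k. real (card (edges (G k) - label_edges (verts (G k)) (L k))) \<le> \<delta> k * real (n k) ^ 2"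
    by metis
  have gw: "graph_with (n k) (m k) (G k)" for k using mx by (auto simp: maximizes_colorings_def)
  have fV: "finite (verts (G k))" and cV: "card (verts (G k)) = n k" and cE: "card (edges (G k)) = m k"
    and fE: "finite (edges (G k))" for k
    using gw[of k] by (auto simp: graph_with_def simple_graph_def intro: finite_subset[of _ "Pow (verts (G k))"])
  have n0: "n k > 0" "real (n k) > 0" for k using n[of k] by auto
  have V: "verts (G k) \<noteq> {}" for k using cV[of k] n0[of k] by auto

  define a where "a k = profile (verts (G k)) (L k)" for k
  define g where "g k = real (m k) / real (n k) ^ 2" for k
  have a0: "a k A \<ge> 0" for k A by (simp add: a_def profile_def)
  have VVa: "VV q (a k) = 1" for k unfolding a_def by (rule VV_profile[OF fV V L])
  have a1: "\<bar>a k A\<bar> \<le> 1" for k A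
    using card_mono[OF fV, of "{v \<in> verts (G k). L k v = A}" k] n0[of k]
    by (simp add: a_def profile_def divide_le_eq_1 cV)
  have g0: "g k \<ge> 0" and g1: "g k \<le> \<kappa>" for k
    using m\<kappa>[of k] n0[of k] by (auto simp: g_def divide_le_eq)
  \<comment> \<open>All but \<delta> n^2 edges join disjoint labels; in the limit this gives
    feasibility of \<alpha>.\<close>
  have gE: "g k \<le> EE q (a k) + \<delta> k" for k
  proof -
    have "card (edges (G k)) \<le> card (label_edges (verts (G k)) (L k) \<union> (edges (G k) - label_edges (verts (G k)) (L k)))"
      using fE finite_label_edges[OF fV] by (intro card_mono) auto
    also have "\<dots> \<le> card (label_edges (verts (G k)) (L k)) + card (edges (G k) - label_edges (verts (G k)) (L k))"
      by (rule card_Un_le)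
    finally have "real (m k) \<le> EE q (a k) * real (n k) ^ 2 + \<delta> k * real (n k) ^ 2"
      using few[of k] EE_profile[OF fV V L, of k] by (simp add: a_def cV cE)
    then show ?thesis using n0[of k] by (simp add: g_def divide_le_eq distrib_right)
  qed
  have obj: "ln (real (num_colorings q (G k))) \<le> real (n k) * (OBJ q (a k) + \<delta> k)" for k
    using ub[of k] OBJ_profile[OF fV V L, of k] by (simp add: a_def cV algebra_simps)

  obtain r1 \<alpha> where r1: "strict_mono r1" "\<And>A. A \<in> indices q \<Longrightarrow> (\<lambda>k. a (r1 k) A) \<longlonglongrightarrow> \<alpha> A"
    using convergent_subsequence[OF finite_indices, of q a "\<lambda>_. 1"] a1 by blast
  have "bounded (range (\<lambda>k. g (r1 k)))"
    using g0 g1 by (auto simp: bounded_iff intro!: exI[of _ \<kappa>])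
  then obtain \<gamma> r2 where r2: "strict_mono r2" "(\<lambda>k. g (r1 (r2 k))) \<longlonglongrightarrow> \<gamma>"
    using bounded_imp_convergent_subsequence[of "\<lambda>k. g (r1 k)"] by (auto simp: o_def)
  define r where "r k = r1 (r2 k)" for k
  have r: "strict_mono r" using strict_mono_o[OF r1(1) r2(1)] by (simp add: r_def[abs_def] o_def)
  have rk: "k \<le> r k" for k using strict_mono_imp_increasing[OF r] by simp
  have gl: "(\<lambda>k. g (r k)) \<longlonglongrightarrow> \<gamma>" using r2(2) by (simp add: r_def)
  have al: "(\<lambda>k. a (r k) A) \<longlonglongrightarrow> \<alpha> A" if "A \<in> indices q" for A
    using LIMSEQ_subseq_LIMSEQ[OF r1(2)[OF that] r2(1)] by (simp add: r_def o_def)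
  have dl: "(\<lambda>k. \<delta> (r k)) \<longlonglongrightarrow> 0" using LIMSEQ_subseq_LIMSEQ[OF \<delta>0 r] by (simp add: o_def)
  have nl: "(\<lambda>k. 1 / real (n (r k))) \<longlonglongrightarrow> 0"
  proof (rule tendsto_sandwich[OF _ _ tendsto_const \<delta>0])
    have "1 / real (n (r k)) \<le> \<delta> k" for k
      using n[of "r k"] rk[of k] unfolding \<delta>_def inverse_eq_divide by (intro divide_left_mono) auto
    then show "\<forall>\<^sub>F k in sequentially. 1 / real (n (r k)) \<le> \<delta> k" by simp
  qed simp
  have EEl: "(\<lambda>k. EE q (a (r k))) \<longlonglongrightarrow> EE q \<alpha>" by (rule EE_tendsto) (rule al)
  have OBJl: "(\<lambda>k. OBJ q (a (r k))) \<longlonglongrightarrow> OBJ q \<alpha>" by (rule OBJ_tendsto) (rule al)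

  have \<alpha>0: "\<alpha> A \<ge> 0" if "A \<in> indices q" for A
    by (rule LIMSEQ_le_const[OF al[OF that]]) (use a0 in blast)
  have "(\<lambda>k. VV q (a (r k))) \<longlonglongrightarrow> VV q \<alpha>"
    unfolding VV_def by (rule tendsto_sum) (rule al)
  then have VV\<alpha>: "VV q \<alpha> = 1" unfolding VVa by (simp add: LIMSEQ_const_iff)
  have "\<gamma> \<le> EE q \<alpha> + 0"
    by (rule LIMSEQ_le[OF gl tendsto_add[OF EEl dl]]) (use gE in blast)
  then have \<alpha>F: "\<alpha> \<in> FEAS q \<gamma>" using \<alpha>0 VV\<alpha> by (simp add: FEAS_def)
  have \<gamma>0: "\<gamma> \<ge> 0" by (rule LIMSEQ_le_const[OF gl]) (use g0 in blast)
  have \<gamma>\<kappa>: "\<gamma> \<le> \<kappa>" by (rule LIMSEQ_le_const2[OF gl]) (use g1 in blast)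

  have max: "OBJ q \<beta> \<le> OBJ q \<alpha>" if \<beta>: "\<beta> \<in> FEAS q \<gamma>" for \<beta>
  proof (rule ccontr)
    assume "\<not> OBJ q \<beta> \<le> OBJ q \<alpha>"
    then have "OBJ q \<beta> > OBJ q \<alpha>" by simp
    \<comment> \<open>Strict slack is essential: the densities \<open>g (r k)\<close> only converge
      to \<gamma> and may exceed it, and realising the vector on vertices involves rounding.\<close>
    then obtain \<beta>' where \<beta>': "\<beta>' \<in> FEAS q \<gamma>" "EE q \<beta>' > \<gamma>" "OBJ q \<beta>' > OBJ q \<alpha>"
      using FEAS_improve_EE[OF \<beta>, of "OBJ q \<alpha>"] OBJ_nonneg[of q \<alpha>] \<alpha>0 by blast
    have "\<exists>M. M \<in> verts (G k) \<rightarrow> indices q \<and>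
        (\<forall>A\<in>indices q. \<bar>real (n k) * \<beta>' A - real (card {v \<in> verts (G k). M v = A})\<bar> < 1)" for k
      using exists_proportional_labelling[OF fV[of k], of q \<beta>'] \<beta>'(1) unfolding cV[of k] FEAS_def by blast
    then have "\<exists>M. \<forall>k. M k \<in> verts (G k) \<rightarrow> indices q \<and>
        (\<forall>A\<in>indices q. \<bar>real (n k) * \<beta>' A - real (card {v \<in> verts (G k). M k v = A})\<bar> < 1)"
      by (intro choice allI)
    then obtain M where M: "\<And>k. M k \<in> verts (G k) \<rightarrow> indices q"
      "\<And>k A. A \<in> indices q \<Longrightarrow> \<bar>real (n k) * \<beta>' A - real (card {v \<in> verts (G k). M k v = A})\<bar> < 1"
      by blast
    define b where "b k = profile (verts (G k)) (M k)" for k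
    have bl: "(\<lambda>k. b (r k) A) \<longlonglongrightarrow> \<beta>' A" if A: "A \<in> indices q" for A
    proof -
      have "\<bar>b k A - \<beta>' A\<bar> \<le> 1 / real (n k)" for k
      proof -
        have "real (n k) * (b k A - \<beta>' A) = real (card {v \<in> verts (G k). M k v = A}) - real (n k) * \<beta>' A"
          using n0(2)[of k] unfolding b_def profile_def cV right_diff_distrib by simp
        then have "\<bar>real (n k) * (b k A - \<beta>' A)\<bar> \<le> 1" using M(2)[OF A, of k] by linarith
        then have "real (n k) * \<bar>b k A - \<beta>' A\<bar> \<le> 1" by (simp only: abs_mult abs_of_nat)
        then show ?thesis using n0[of k] by (simp add: le_divide_eq mult.commute)
      qed
      then have "\<forall>\<^sub>F k in sequentially. norm (b (r k) A - \<beta>' A) \<le> 1 / real (n (r k))" by simp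
      then have "(\<lambda>k. b (r k) A - \<beta>' A) \<longlonglongrightarrow> 0" using nl by (rule Lim_null_comparison)
      then show ?thesis by (rule LIM_zero_cancel)
    qed
    have "(\<lambda>k. EE q (b (r k)) - g (r k)) \<longlonglongrightarrow> EE q \<beta>' - \<gamma>"
      by (intro tendsto_diff EE_tendsto bl gl)
    then have "\<forall>\<^sub>F k in sequentially. EE q (b (r k)) - g (r k) > 0"
      using \<beta>'(2) by (intro order_tendstoD(1)) auto
    \<comment> \<open>The competitor has enough edges, so the number of colourings of the maximizer
      is bounded below through \<open>b\<close> and above through \<open>a\<close>; take logarithms
      and divide by the number of vertices.\<close>
    then have "\<forall>\<^sub>F k in sequentially. OBJ q (b (r k)) \<le> OBJ q (a (r k)) + \<delta> (r k)"
    proof eventually_elim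
      case (elim k)
      have "real (m (r k)) \<le> EE q (b (r k)) * real (n (r k)) ^ 2"
        using elim n0[of "r k"] by (simp add: g_def divide_less_eq)
      then have "real (n (r k)) * OBJ q (b (r k)) \<le> ln (real (num_colorings q (G (r k))))"
        unfolding b_def by (intro maximizer_lower_bound[OF mx n0(1) M(1)])
      with obj[of "r k"] have "real (n (r k)) * OBJ q (b (r k)) \<le> real (n (r k)) * (OBJ q (a (r k)) + \<delta> (r k))"
        by linarith
      then show ?case using n0[of "r k"] by (simp only: mult_le_cancel_left_pos)
    qed
    then have "OBJ q \<beta>' \<le> OBJ q \<alpha> + 0"
      by (intro tendsto_le[OF _ tendsto_add[OF OBJl dl] OBJ_tendsto[OF bl]]) auto
    with \<beta>'(3) show False by simp
  qed
  \<comment> \<open>Equality makes \<open>EE q (a (r k)) - g (r k)\<close> vanish in the limit, so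
    that the label graph has hardly more edges than \<open>G (r k)\<close>.\<close>
  have EE\<alpha>: "EE q \<alpha> = \<gamma>" by (rule EE_eq_of_maximal[OF q0 \<gamma>0 \<alpha>F max])
  have sol: "solves_OPT q \<gamma> \<alpha>" by (rule maximal_solves_OPT[OF \<alpha>F max])

  have "(\<lambda>k. 2 * \<delta> (r k) + (EE q (a (r k)) - g (r k)) + (\<Sum>A\<in>indices q. \<bar>a (r k) A - \<alpha> A\<bar> + 1 / real (n (r k))))
      \<longlonglongrightarrow> 2 * 0 + (EE q \<alpha> - \<gamma>) + (\<Sum>A\<in>indices q. \<bar>\<alpha> A - \<alpha> A\<bar> + 0)"
    by (intro tendsto_add tendsto_diff tendsto_sum tendsto_mult tendsto_rabs tendsto_const al gl dl nl EEl)
  then have "\<forall>\<^sub>F k in sequentially. 2 * \<delta> (r k) + (EE q (a (r k)) - g (r k)) +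
      (\<Sum>A\<in>indices q. \<bar>a (r k) A - \<alpha> A\<bar> + 1 / real (n (r k))) < \<epsilon>"
    using assms(2) EE\<alpha> by (intro order_tendstoD(2)) auto
  moreover have "\<forall>\<^sub>F k in sequentially. dist (g (r k)) \<gamma> < \<epsilon>"
    using gl assms(2) by (rule tendstoD)
  ultimately have "\<forall>\<^sub>F k in sequentially. False"
  proof eventually_elim
    case (elim k)
    obtain H :: "nat graph" where "is_G_alpha q \<alpha> (n (r k)) H" "is_close (\<epsilon> * real (n (r k)) ^ 2) (G (r k)) H"
      by (rule exists_close_G_alpha[OF gw n0(1) L \<alpha>0 VV\<alpha> few elim(1)[THEN less_imp_le, unfolded a_def g_def]])
    moreover have "\<bar>\<gamma> - real (m (r k)) / real (n (r k)) ^ 2\<bar> \<le> \<epsilon>"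
      using elim(2) by (simp add: g_def dist_real_def abs_minus_commute)
    ultimately have "good (n (r k)) (m (r k)) (G (r k))" using \<gamma>\<kappa> sol unfolding good_def by blast
    with ng show False by blast
  qed
  then show False by simp
qed

end
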